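(* Let $G=S_\infty$, the group of all permutations of $\omega$ with the topology of pointwise convergence. There exist $x\neq y$ in $K(S(G))$ such that for every minimal subflow $M\subseteq S(G)$ and every retraction $\phi:S(G)\to M$, we have $\phi(x)=\phi(y)$.
   Context: $S(G)$ is the Samuel compactification of $G$ with respect to its left uniformity; it is a $G$-flow (compact Hausdorff space with continuous right $G$-action extending right multiplication) and the greatest $G$-ambit with distinguished point $1_G$. It carries a compact left-topological semigroup structure: for $x\in S(G)$, $\lambda_x:S(G)\to\overline{xG}$ is the unique continuous $G$-equivariant map with $\lambda_x(1_G)=x$, and $xy:=\lambda_x(y)$. $K(S(G))$ denotes the smallest two-sided ideal of this semigroup. A subflow is a nonempty closed $G$-invariant subset; it is minimal if it contains no proper subflow. A retraction onto a minimal subflow $M$ is a continuous $G$-equivariant map $\phi:S(G)\to M$ with $\phi|_M=\mathrm{id}_M$. *)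

theory Defs
  imports "HOL-Analysis.Analysis"
begin

(* G = S_infinity: the bijections of nat, group law = composition (g*h = g o h),
   identity = id.  The topology of pointwise convergence is the product topology
   on nat => nat (nat discrete), restricted to G. *)

type_synonym perm = "nat \<Rightarrow> nat"
type_synonym gfun = "perm \<Rightarrow> real"
type_synonym spt = "gfun \<Rightarrow> real"

definition Sinf :: "perm set" where
  "Sinf = {g. bij g}"

definition nhd_id :: "perm set \<Rightarrow> bool" where
  "nhd_id V \<longleftrightarrow> (\<exists>U. open U \<and> id \<in> U \<and> U \<inter> Sinf \<subseteq> V)"

(* bounded real functions on G, uniformly continuous w.r.t. the left uniformity
   (entourages {(g,h). g^-1 h \<in> V}); extensional (0 outside G) *)
definition LUC :: "gfun set" where
  "LUC = {f. (\<forall>h. h \<notin> Sinf \<longrightarrow> f h = 0) \<and> bounded (f ` Sinf) \<and>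
     (\<forall>e>0. \<exists>V. nhd_id V \<and>
        (\<forall>g\<in>Sinf. \<forall>h\<in>Sinf. inv g \<circ> h \<in> V \<longrightarrow> \<bar>f g - f h\<bar> < e))}"

(* Samuel compactification S(G) = Gelfand space (real characters) of LUC,
   points extensional (0 off LUC), with the weak-* (product) topology *)
definition SG :: "spt set" where
  "SG = {p. (\<forall>f. f \<notin> LUC \<longrightarrow> p f = 0) \<and>
     p (\<lambda>h. if h \<in> Sinf then 1 else 0) = 1 \<and>
     (\<forall>f\<in>LUC. \<forall>f'\<in>LUC. p (\<lambda>h. f h + f' h) = p f + p f' \<and>
                         p (\<lambda>h. f h * f' h) = p f * p f') \<and>
     (\<forall>c. \<forall>f\<in>LUC. p (\<lambda>h. c * f h) = c * p f)}"

definition sg_one :: spt where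
  "sg_one = (\<lambda>f. if f \<in> LUC then f id else 0)"

(* right action of G on S(G), extending right multiplication h \<mapsto> h g *)
definition sg_act :: "spt \<Rightarrow> perm \<Rightarrow> spt" where
  "sg_act p g = (\<lambda>f. if f \<in> LUC then p (\<lambda>h. if h \<in> Sinf then f (h \<circ> g) else 0) else 0)"

definition sg_equivariant :: "(spt \<Rightarrow> spt) \<Rightarrow> bool" where
  "sg_equivariant \<phi> \<longleftrightarrow> (\<forall>p\<in>SG. \<forall>g\<in>Sinf. \<phi> (sg_act p g) = sg_act (\<phi> p) g)"

(* lambda_x: the unique continuous G-equivariant map S(G) \<rightarrow> S(G) with 1_G \<mapsto> x
   (made extensional outside S(G) so that THE is meaningful) *)
definition sg_lambda :: "spt \<Rightarrow> spt \<Rightarrow> spt" where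
  "sg_lambda x = (THE l. continuous_on SG l \<and> l ` SG \<subseteq> SG \<and> sg_equivariant l \<and>
       l sg_one = x \<and> (\<forall>p. p \<notin> SG \<longrightarrow> l p = undefined))"

definition sg_mult :: "spt \<Rightarrow> spt \<Rightarrow> spt" where
  "sg_mult x y = sg_lambda x y"

definition sg_ideal :: "spt set \<Rightarrow> bool" where
  "sg_ideal I \<longleftrightarrow> I \<noteq> {} \<and> I \<subseteq> SG \<and>
     (\<forall>a\<in>SG. \<forall>b\<in>I. sg_mult a b \<in> I \<and> sg_mult b a \<in> I)"

definition KSG :: "spt set" where
  "KSG = (THE K. sg_ideal K \<and> (\<forall>J. sg_ideal J \<longrightarrow> K \<subseteq> J))"

definition sg_subflow :: "spt set \<Rightarrow> bool" where
  "sg_subflow M \<longleftrightarrow> M \<noteq> {} \<and> M \<subseteq> SG \<and> closedin (top_of_set SG) M \<and>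
     (\<forall>p\<in>M. \<forall>g\<in>Sinf. sg_act p g \<in> M)"

definition sg_minimal_subflow :: "spt set \<Rightarrow> bool" where
  "sg_minimal_subflow M \<longleftrightarrow> sg_subflow M \<and> (\<forall>N. sg_subflow N \<and> N \<subseteq> M \<longrightarrow> N = M)"

definition sg_retraction :: "spt set \<Rightarrow> (spt \<Rightarrow> spt) \<Rightarrow> bool" where
  "sg_retraction M \<phi> \<longleftrightarrow> continuous_on SG \<phi> \<and> \<phi> ` SG \<subseteq> M \<and> sg_equivariant \<phi> \<and>
     (\<forall>p\<in>M. \<phi> p = p)"

end

(*
  Fix a nonprincipal ultrafilter V on nat and a pairing function <_,_>.  For V-generic
  c_0 < c_1 < ..., let x be the point of S(G) whose restriction to {0..<n} is
  i |-> <c_(2i), c_(2i+1)>, and y the point whose restriction is i |-> <c_i, c_(n+i)>.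
  Both points p are order-indiscernible: p t depends only on the order {(a,b). t a < t b} that
  t induces on nat.  Since every linear order contains arbitrarily long increasing chains, for each w
  there is v with p w v = p, so p lies in every two-sided ideal.

  For every w, the points w x and w y induce the same order.  Write ij for <c_i,c_j>.  If, in the
  order induced by w, generically 01 < 23 but not 02 < 13, then 02, 13, 24, 35, 46 is weakly
  decreasing, although 02 < 46; the opposite case is similar.
  Hence x w x = x w y for all w.

  A retraction phi onto a minimal subflow M is p |-> u p with u = phi 1, and minimality gives
  u = u x w for some w.  So phi x = u x w x = u x w y = phi y.
*)
theory Submission
  imports Defs
begin

section \<open>Ultrafilters\<close>

text \<open>The left uniformity sees a permutation only through its restrictions to initial
  segments, so a point of S(G) amounts to a coherent family of ultrafilters on finite injective
  tuples. In a product \<open>p t\<close> the right factor only chooses the arguments at which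
  \<open>p\<close> is evaluated; this is why an order-indiscernible \<open>p\<close> forgets
  everything about \<open>t\<close> except its order. In \<open>w p\<close> the order compares
  values of \<open>p\<close> by the order of \<open>w\<close>. To separate x from y one needs a
  relation between values that a continuous function detects but an order of \<open>w\<close>
  generically cannot. This is the purpose of coding pairs: whether two pairs follow one another or
  interlock is visible in their coordinates, while transitivity forces a linear order on the codes
  to treat both configurations alike.\<close>

definition ultra :: "'a filter \<Rightarrow> bool" where
  "ultra U \<longleftrightarrow> U \<noteq> bot \<and> (\<forall>P. eventually P U \<or> eventually (\<lambda>x. \<not> P x) U)"

lemma ultra_nontrivial: "ultra U \<Longrightarrow> U \<noteq> bot"
  by (simp add: ultra_def)

lemma ultra_eventually_not:
  assumes "ultra U"
  shows "eventually (\<lambda>x. \<not> P x) U \<longleftrightarrow> \<not> eventually P U"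
proof
  assume "eventually (\<lambda>x. \<not> P x) U"
  then show "\<not> eventually P U"
    using assms eventually_conj[of P U "\<lambda>x. \<not> P x"] by (auto simp: ultra_def trivial_limit_def)
next
  assume "\<not> eventually P U"
  then show "eventually (\<lambda>x. \<not> P x) U"
    using assms by (auto simp: ultra_def)
qed

text \<open>Zorn's lemma yields a minimal proper filter below \<open>F\<close>: a chain is a filter
  base of its infimum, which therefore stays proper. A minimal proper filter decides every
  \<open>P\<close>, because cutting it down to \<open>P\<close> gives either \<open>bot\<close> or
  the same filter.\<close>

lemma ex_ultra_le:
  assumes "F \<noteq> bot"
  shows "\<exists>U\<le>F. ultra U"
proof -
  define A where "A = {G. G \<le> F \<and> G \<noteq> bot}"
  define le where "le = (\<lambda>G H :: 'a filter. H \<le> G)"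
  have "\<exists>m\<in>A. \<forall>a\<in>A. le m a \<longrightarrow> a = m"
  proof (rule predicate_Zorn)
    show "partial_order_on A (relation_of le A)"
      by (rule partial_order_on_relation_ofI) (auto simp: le_def)
  next
    fix C assume C: "C \<in> Chains (relation_of le A)"
    then have CA: "C \<subseteq> A"
      by (rule Chains_relation_of)
    show "\<exists>u\<in>A. \<forall>a\<in>C. le a u"
    proof (cases "C = {}")
      case True
      then show ?thesis
        using assms by (auto simp: A_def)
    next
      case False
      have base: "\<exists>x\<in>C. x \<le> inf G H" if "G \<in> C" "H \<in> C" for G H
      proof -
        have "G \<le> H \<or> H \<le> G"
          using C that by (auto simp: Chains_def relation_of_def le_def)
        then show ?thesis
          using that by (auto simp: inf_absorb1 inf_absorb2)
      qed
      have "eventually (\<lambda>_. False) (Inf C) \<longleftrightarrow> (\<exists>b\<in>C. eventually (\<lambda>_. False) b)"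
        using False base by (rule eventually_Inf_base)
      then have "Inf C \<noteq> bot"
        using CA by (auto simp: A_def trivial_limit_def)
      moreover have "Inf C \<le> F"
        using False CA by (auto simp: A_def intro: Inf_lower2)
      ultimately show ?thesis
        by (auto simp: A_def le_def intro!: bexI[of _ "Inf C"] Inf_lower)
    qed
  qed
  then obtain U where U: "U \<le> F" "U \<noteq> bot" and max: "\<And>G. G \<le> U \<Longrightarrow> G \<noteq> bot \<Longrightarrow> G = U"
    unfolding A_def le_def by (metis (mono_tags, lifting) mem_Collect_eq order_trans)
  have "eventually P U" if "\<not> eventually (\<lambda>x. \<not> P x) U" for P
  proof -
    have "inf U (principal {x. P x}) \<noteq> bot"
      using that by (auto simp: trivial_limit_def eventually_inf_principal)
    then have "inf U (principal {x. P x}) = U"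
      by (intro max) auto
    then have "U \<le> principal {x. P x}"
      by (metis inf.cobounded2)
    then show ?thesis
      by (simp add: le_principal)
  qed
  then show ?thesis
    using U by (auto simp: ultra_def)
qed

text \<open>Compactness provides a cluster point, and an ultrafilter converges to each of its
  cluster points since it decides every neighbourhood.\<close>

lemma ultra_convergent:
  assumes U: "ultra U" and K: "compact K" "eventually (\<lambda>x. f x \<in> K) U"
  shows "\<exists>l\<in>K. (f \<longlongrightarrow> l) U"
proof -
  let ?F = "filtermap f U"
  have "?F \<noteq> bot"
    using U by (simp add: ultra_def filtermap_bot_iff)
  moreover have "eventually (\<lambda>x. x \<in> K) ?F"
    using K by (simp add: eventually_filtermap)
  ultimately obtain l where l: "l \<in> K" "inf (nhds l) ?F \<noteq> bot"
    using K(1) unfolding compact_filter by blast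
  have "eventually (\<lambda>x. f x \<in> S) U" if S: "open S" "l \<in> S" for S
  proof (rule ccontr)
    assume "\<not> eventually (\<lambda>x. f x \<in> S) U"
    then have "eventually (\<lambda>y. y \<notin> S) ?F"
      using U by (auto simp: ultra_def eventually_filtermap)
    moreover have "eventually (\<lambda>y. y \<in> S) (nhds l)"
      using S by (auto simp: eventually_nhds)
    ultimately have "eventually (\<lambda>_. False) (inf (nhds l) ?F)"
      unfolding eventually_inf by blast
    then show False
      using l(2) by (simp add: trivial_limit_def)
  qed
  then show ?thesis
    using l(1) by (auto intro: topological_tendstoI)
qed

lemma ex_nonprincipal_ultra: "\<exists>V :: nat filter. ultra V \<and> V \<le> sequentially"
  using ex_ultra_le[of sequentially] by auto


section \<open>Iterated ultrafilter quantifiers\<close>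

text \<open>\<open>gen V n P\<close> says that \<open>P c\<close> holds for \<open>V\<close>-almost all \<open>c 0\<close>, for \<open>V\<close>-almost all \<open>c 1\<close>, \dots,
  for \<open>V\<close>-almost all \<open>c (n - 1)\<close>; the later entries of \<open>c\<close> are filled with \<open>0\<close>.\<close>

primrec gen :: "nat filter \<Rightarrow> nat \<Rightarrow> ((nat \<Rightarrow> nat) \<Rightarrow> bool) \<Rightarrow> bool" where
  "gen V 0 P \<longleftrightarrow> P (\<lambda>_. 0)"
| "gen V (Suc n) P \<longleftrightarrow> eventually (\<lambda>a. gen V n (\<lambda>c. P (case_nat a c))) V"

lemma gen_mono:
  assumes "gen V n P" "\<And>c. P c \<Longrightarrow> Q c"
  shows "gen V n Q"
  using assms
proof (induction n arbitrary: P Q)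
  case (Suc n)
  from Suc.prems(1) have "eventually (\<lambda>a. gen V n (\<lambda>c. P (case_nat a c))) V"
    by simp
  then have "eventually (\<lambda>a. gen V n (\<lambda>c. Q (case_nat a c))) V"
    by (rule eventually_mono) (rule Suc.IH, assumption, rule Suc.prems(2))
  then show ?case
    by simp
qed simp

lemma gen_conj: "gen V n (\<lambda>c. P c \<and> Q c) \<longleftrightarrow> gen V n P \<and> gen V n Q"
  by (induction n arbitrary: P Q) (auto simp: eventually_conj_iff)

context
  fixes V :: "nat filter"
  assumes V: "ultra V"
begin

lemma gen_const: "gen V n (\<lambda>_. b) \<longleftrightarrow> b"
  by (induction n) (auto simp: eventually_const_iff ultra_nontrivial[OF V])

text \<open>Each ultrafilter quantifier commutes with negation, hence so does their iteration:
  \<open>gen V n\<close> is the quantifier of the \<open>n\<close>-fold product ultrafilter.\<close>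

lemma gen_not: "gen V n (\<lambda>c. \<not> P c) \<longleftrightarrow> \<not> gen V n P"
proof (induction n arbitrary: P)
  case (Suc n)
  show ?case
    by (simp only: gen.simps Suc ultra_eventually_not[OF V])
qed simp

lemma gen_ball:
  assumes "finite A"
  shows "gen V n (\<lambda>c. \<forall>i\<in>A. P i c) \<longleftrightarrow> (\<forall>i\<in>A. gen V n (P i))"
  using assms by (induction A) (auto simp: gen_const gen_conj)

text \<open>Quantifiers at positions missed by \<open>s\<close> bind dummy variables and disappear
  because \<open>V\<close> is proper. Monotonicity of \<open>s\<close> keeps the order of the
  others, as iterated ultrafilter quantifiers do not commute.\<close>

lemma gen_reindex:
  assumes "strict_mono_on {..<r} s" "s ` {..<r} \<subseteq> {..<n}"
    and "\<And>c c'. (\<And>i. i < r \<Longrightarrow> c i = c' i) \<Longrightarrow> P c = P c'"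
  shows "gen V n (\<lambda>c. P (c \<circ> s)) \<longleftrightarrow> gen V r P"
  using assms
proof (induction n arbitrary: r s P)
  case 0
  then have "r = 0"
    by auto
  then have "P ((\<lambda>_. 0) \<circ> s) = P (\<lambda>_. 0)"
    by (intro 0(3)) auto
  then show ?case
    using \<open>r = 0\<close> by simp
next
  case (Suc n)
  show ?case
  proof (cases r)
    case 0
    then have "P c = P (\<lambda>_. 0)" for c
      using Suc.prems(3) by simp
    then obtain b where "P = (\<lambda>_. b)"
      by blast
    then show ?thesis
      by (simp only: gen_const)
  next
    case (Suc q)
    have less: "s i < s j" if "i < j" "j < r" for i j
      using Suc.prems(1) that by (simp add: strict_mono_on_def)
    have below: "s i < Suc n" if "i < r" for i
      using Suc.prems(2) that by auto
    \<comment> \<open>The outermost quantifier either binds argument 0 of \<open>P\<close> and is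
      stripped from both sides, or binds a dummy and is dropped. In both cases \<open>t\<close>
      renumbers the remaining positions.\<close>
    show ?thesis
    proof (cases "s 0 = 0")
      case True
      define t where "t i = s (Suc i) - 1" for i
      have pos: "s (Suc i) > 0" if "i < q" for i
        using less[of 0 "Suc i"] that Suc by auto
      have "gen V n (\<lambda>c. P (case_nat a c \<circ> s)) = gen V q (\<lambda>c. P (case_nat a c))" for a
      proof -
        have "P (case_nat a c \<circ> s) = P (case_nat a (c \<circ> t))" for c
        proof (rule Suc.prems(3))
          fix i assume "i < r"
          then show "(case_nat a c \<circ> s) i = case_nat a (c \<circ> t) i"
            using True pos[of "i - 1"] Suc by (cases i) (auto simp: t_def split: nat.split)
        qed
        then have "gen V n (\<lambda>c. P (case_nat a c \<circ> s)) = gen V n (\<lambda>c. P (case_nat a (c \<circ> t)))"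
          by simp
        also have "\<dots> = gen V q (\<lambda>c. P (case_nat a c))"
        proof (rule Suc.IH)
          show "strict_mono_on {..<q} t"
          proof (rule strict_mono_onI)
            fix i j assume "i \<in> {..<q}" "j \<in> {..<q}" "i < j"
            then show "t i < t j"
              using less[of "Suc i" "Suc j"] pos[of i] pos[of j] Suc by (auto simp: t_def)
          qed
          show "t ` {..<q} \<subseteq> {..<n}"
            using below pos Suc by (force simp: t_def)
        next
          fix c c' :: "nat \<Rightarrow> nat" assume "\<And>i. i < q \<Longrightarrow> c i = c' i"
          then show "P (case_nat a c) = P (case_nat a c')"
            by (intro Suc.prems(3)) (auto simp: Suc split: nat.split)
        qed
        finally show ?thesis .
      qed
      then show ?thesis
        by (simp only: Suc gen.simps)
    next
      case False
      define t where "t i = s i - 1" for i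
      have pos: "s i > 0" if "i < r" for i
        using less[of 0 i] that False by (cases "i = 0") auto
      have "gen V n (\<lambda>c. P (case_nat a c \<circ> s)) = gen V r P" for a
      proof -
        have "P (case_nat a c \<circ> s) = P (c \<circ> t)" for c
          by (rule Suc.prems(3)) (auto simp: t_def split: nat.split dest: pos)
        then have "gen V n (\<lambda>c. P (case_nat a c \<circ> s)) = gen V n (\<lambda>c. P (c \<circ> t))"
          by simp
        also have "\<dots> = gen V r P"
        proof (rule Suc.IH)
          show "strict_mono_on {..<r} t"
          proof (rule strict_mono_onI)
            fix i j assume "i \<in> {..<r}" "j \<in> {..<r}" "i < j"
            then show "t i < t j"
              using less[of i j] pos[of i] pos[of j] by (auto simp: t_def)
          qed
          show "t ` {..<r} \<subseteq> {..<n}"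
            using below pos by (force simp: t_def)
        qed (use Suc.prems(3) in blast)
        finally show ?thesis .
      qed
      then show ?thesis
        by (simp only: gen.simps eventually_const_iff ultra_nontrivial[OF V] simp_thms if_False)
    qed
  qed
qed

lemma gen_less:
  assumes "V \<le> sequentially" "i < j" "j < n"
  shows "gen V n (\<lambda>c. c i < c j)"
proof -
  have "gen V 2 (\<lambda>c. c 0 < c 1)"
    using assms(1) eventually_gt_at_top[of "_::nat"]
    by (auto simp: numeral_2_eq_2 filter_leD)
  moreover have "gen V n (\<lambda>c. (\<lambda>c. c 0 < c 1) (c \<circ> case_nat i (\<lambda>_. j))) = gen V 2 (\<lambda>c. c 0 < c 1)"
    by (rule gen_reindex)
      (use assms in \<open>auto simp: strict_mono_on_def less_Suc_eq numeral_2_eq_2 split: nat.split\<close>)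
  ultimately show ?thesis
    by simp
qed

end

lemma gen_strict_mono:
  assumes V: "ultra V" "V \<le> sequentially"
  shows "gen V n (\<lambda>c. strict_mono_on {..<n} c)"
proof -
  have "finite {(i, j). i < j \<and> j < n}"
    by (rule finite_subset[of _ "{..<n} \<times> {..<n}"]) auto
  then have "gen V n (\<lambda>c. \<forall>p\<in>{(i, j). i < j \<and> j < n}. c (fst p) < c (snd p))"
    using gen_less[OF V] by (subst gen_ball[OF V(1)]) auto
  then show ?thesis
    by (rule gen_mono) (auto simp: strict_mono_on_def)
qed

lemma gen_four:
  assumes V: "ultra V" and less: "i < j" "j < k" "k < l" "l < n"
  shows "gen V n (\<lambda>c. Q (c i) (c j) (c k) (c l)) \<longleftrightarrow> gen V 4 (\<lambda>c. Q (c 0) (c 1) (c 2) (c 3))"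
proof -
  define s :: "nat \<Rightarrow> nat" where
    "s m = (if m = 0 then i else if m = 1 then j else if m = 2 then k else l)" for m
  define P where "P = (\<lambda>c :: nat \<Rightarrow> nat. Q (c 0) (c 1) (c 2) (c 3))"
  have "gen V n (\<lambda>c. P (c \<circ> s)) \<longleftrightarrow> gen V 4 P"
  proof (rule gen_reindex[OF V])
    show "strict_mono_on {..<4} s"
      using less by (auto simp: strict_mono_on_def s_def)
    show "s ` {..<4} \<subseteq> {..<n}"
      using less by (auto simp: s_def)
  qed (simp add: P_def)
  then show ?thesis
    by (simp add: P_def s_def)
qed

text \<open>Inside the finite set \<open>T\<close> the complements of domain and range have the same
  size, so a bijection between them completes \<open>s\<close> on \<open>T\<close>; off
  \<open>T\<close> the identity is used.\<close>

lemma inj_on_extends_bij: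
  fixes s :: "nat \<Rightarrow> nat"
  assumes "inj_on s {..<n}"
  obtains k where "bij k" "\<And>i. i < n \<Longrightarrow> k i = s i"
proof -
  define T where "T = {..<n} \<union> s ` {..<n}"
  have "card (T - {..<n}) = card (T - s ` {..<n})"
    using card_image[OF assms] by (simp add: T_def card_Diff_subset)
  then obtain g where g: "bij_betw g (T - {..<n}) (T - s ` {..<n})"
    using finite_same_card_bij[of "T - {..<n}" "T - s ` {..<n}"] by (auto simp: T_def)
  define k where "k i = (if i < n then s i else if i \<in> T then g i else i)" for i
  have "bij_betw k {..<n} (s ` {..<n})"
    using assms by (auto simp: bij_betw_def k_def inj_on_def)
  moreover have "bij_betw k (T - {..<n}) (T - s ` {..<n})"
    using g by (rule bij_betw_cong[THEN iffD1, rotated]) (auto simp: k_def)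
  moreover have "bij_betw k (- T) (- T)"
    using bij_betw_id[of "- T"] by (rule bij_betw_cong[THEN iffD1, rotated]) (auto simp: k_def T_def)
  ultimately have "bij_betw k (({..<n} \<union> (T - {..<n})) \<union> - T) ((s ` {..<n} \<union> (T - s ` {..<n})) \<union> - T)"
    by (intro bij_betw_combine) (auto simp: T_def)
  moreover have "({..<n} \<union> (T - {..<n})) \<union> - T = UNIV" "(s ` {..<n} \<union> (T - s ` {..<n})) \<union> - T = UNIV"
    by (auto simp: T_def)
  ultimately have "bij k"
    by simp
  then show thesis
    using that by (auto simp: k_def)
qed


section \<open>Left uniformly continuous functions\<close>

text \<open>Members of \<open>LUC\<close> vanish off the group, so a formula must be cut off before
  it can be a member.\<close>

definition on_G :: "gfun \<Rightarrow> gfun" where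
  "on_G f = (\<lambda>h. if h \<in> Sinf then f h else 0)"

lemma on_G_Sinf [simp]: "h \<in> Sinf \<Longrightarrow> on_G f h = f h"
  by (simp add: on_G_def)

lemma Sinf_id [simp]: "id \<in> Sinf"
  by (simp add: Sinf_def)

lemma Sinf_comp [simp]: "g \<in> Sinf \<Longrightarrow> h \<in> Sinf \<Longrightarrow> g \<circ> h \<in> Sinf"
  by (simp add: Sinf_def bij_comp)

lemma nhd_id_iff: "nhd_id V \<longleftrightarrow> (\<exists>N. {h \<in> Sinf. \<forall>i<N. h i = i} \<subseteq> V)"
proof
  assume "nhd_id V"
  then obtain U where U: "open U" "id \<in> U" "U \<inter> Sinf \<subseteq> V"
    by (auto simp: nhd_id_def)
  then have "openin (product_topology (\<lambda>i. euclidean) UNIV) U"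
    by (simp add: euclidean_product_topology)
  from product_topology_open_contains_basis[OF this U(2)]
  obtain X where X: "id \<in> PiE UNIV X" "finite {i. X i \<noteq> UNIV}" "PiE UNIV X \<subseteq> U"
    by auto
  from X(2) obtain N where N: "\<And>i. X i \<noteq> UNIV \<Longrightarrow> i < N"
    by (auto simp: finite_nat_set_iff_bounded)
  have "h \<in> U" if "\<forall>i<N. h i = i" for h
  proof -
    have "h i \<in> X i" for i
      using that N[of i] X(1) by (cases "X i = UNIV") (auto simp: PiE_UNIV_domain)
    then show ?thesis
      using X(3) by (auto simp: PiE_UNIV_domain)
  qed
  then show "\<exists>N. {h \<in> Sinf. \<forall>i<N. h i = i} \<subseteq> V"
    using U(3) by blast
next
  assume "\<exists>N. {h \<in> Sinf. \<forall>i<N. h i = i} \<subseteq> V"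
  then obtain N where N: "{h \<in> Sinf. \<forall>i<N. h i = i} \<subseteq> V"
    by blast
  have "open {h :: perm. \<forall>i\<in>{..<N}. h (id i) \<in> {i}}"
    by (rule product_topology_basis') (auto simp: open_discrete)
  then show "nhd_id V"
    unfolding nhd_id_def using N
    by (intro exI[of _ "{h. \<forall>i\<in>{..<N}. h (id i) \<in> {i}}"]) auto
qed

text \<open>Since \<open>inv g (h i) = i\<close> means \<open>g i = h i\<close>, the basic
  entourages of the left uniformity are agreement on initial segments.\<close>

lemma LUC_iff:
  "f \<in> LUC \<longleftrightarrow> (\<forall>h. h \<notin> Sinf \<longrightarrow> f h = 0) \<and> bounded (f ` Sinf) \<and>
     (\<forall>e>0. \<exists>N. \<forall>g\<in>Sinf. \<forall>h\<in>Sinf. (\<forall>i<N. g i = h i) \<longrightarrow> \<bar>f g - f h\<bar> < e)"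
proof -
  have eq: "inv g (h i) = i \<longleftrightarrow> g i = h i" if "g \<in> Sinf" for g h i
    using that by (metis Sinf_def bij_inv_eq_iff mem_Collect_eq)
  have "(\<exists>V. nhd_id V \<and> (\<forall>g\<in>Sinf. \<forall>h\<in>Sinf. inv g \<circ> h \<in> V \<longrightarrow> \<bar>f g - f h\<bar> < e)) \<longleftrightarrow>
        (\<exists>N. \<forall>g\<in>Sinf. \<forall>h\<in>Sinf. (\<forall>i<N. g i = h i) \<longrightarrow> \<bar>f g - f h\<bar> < e)" for e
  proof
    assume "\<exists>V. nhd_id V \<and> (\<forall>g\<in>Sinf. \<forall>h\<in>Sinf. inv g \<circ> h \<in> V \<longrightarrow> \<bar>f g - f h\<bar> < e)"
    then obtain V N where "{h \<in> Sinf. \<forall>i<N. h i = i} \<subseteq> V"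
        and V: "\<And>g h. g \<in> Sinf \<Longrightarrow> h \<in> Sinf \<Longrightarrow> inv g \<circ> h \<in> V \<Longrightarrow> \<bar>f g - f h\<bar> < e"
      by (auto simp: nhd_id_iff)
    moreover have "inv g \<circ> h \<in> Sinf" if "g \<in> Sinf" "h \<in> Sinf" for g h
      using that by (simp add: Sinf_def bij_comp bij_imp_bij_inv)
    ultimately have "\<bar>f g - f h\<bar> < e" if "g \<in> Sinf" "h \<in> Sinf" "\<forall>i<N. g i = h i" for g h
      using that eq by (intro V) (auto simp: subset_iff)
    then show "\<exists>N. \<forall>g\<in>Sinf. \<forall>h\<in>Sinf. (\<forall>i<N. g i = h i) \<longrightarrow> \<bar>f g - f h\<bar> < e"
      by blast
  next
    assume "\<exists>N. \<forall>g\<in>Sinf. \<forall>h\<in>Sinf. (\<forall>i<N. g i = h i) \<longrightarrow> \<bar>f g - f h\<bar> < e"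
    then obtain N where "\<forall>g\<in>Sinf. \<forall>h\<in>Sinf. (\<forall>i<N. g i = h i) \<longrightarrow> \<bar>f g - f h\<bar> < e"
      by blast
    then show "\<exists>V. nhd_id V \<and> (\<forall>g\<in>Sinf. \<forall>h\<in>Sinf. inv g \<circ> h \<in> V \<longrightarrow> \<bar>f g - f h\<bar> < e)"
      by (intro exI[of _ "{h. \<forall>i<N. h i = i}"]) (auto simp: nhd_id_iff eq)
  qed
  then show ?thesis
    by (simp add: LUC_def)
qed

lemma LUC_outside: "f \<in> LUC \<Longrightarrow> h \<notin> Sinf \<Longrightarrow> f h = 0"
  by (simp add: LUC_def)

lemma LUC_bounded:
  assumes "f \<in> LUC"
  obtains B where "\<And>h. \<bar>f h\<bar> \<le> B"
proof -
  obtain B where "\<And>h. h \<in> Sinf \<Longrightarrow> \<bar>f h\<bar> \<le> B"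
    using assms unfolding LUC_def bounded_iff by (auto, metis)
  then have "\<bar>f h\<bar> \<le> max B 0" for h
    using LUC_outside[OF assms, of h] by (cases "h \<in> Sinf") (auto simp: le_max_iff_disj)
  then show thesis
    using that[of "max B 0"] by simp
qed

lemma LUC_modulus:
  assumes "f \<in> LUC" "e > 0"
  obtains N where "\<And>g h. g \<in> Sinf \<Longrightarrow> h \<in> Sinf \<Longrightarrow> (\<And>i. i < N \<Longrightarrow> g i = h i) \<Longrightarrow> \<bar>f g - f h\<bar> < e"
  using assms unfolding LUC_iff by metis

lemma on_G_LUC_I:
  assumes "\<And>h. h \<in> Sinf \<Longrightarrow> \<bar>f h\<bar> \<le> B"
    and "\<And>e. e > 0 \<Longrightarrow> \<exists>N. \<forall>g\<in>Sinf. \<forall>h\<in>Sinf. (\<forall>i<N. g i = h i) \<longrightarrow> \<bar>f g - f h\<bar> < e"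
  shows "on_G f \<in> LUC"
proof -
  have "bounded (on_G f ` Sinf)"
    using assms(1) by (intro boundedI[of _ B]) auto
  then show ?thesis
    using assms(2) by (auto simp: LUC_iff on_G_def)
qed

lemma on_G_LUC_cylinder:
  assumes "\<And>h. h \<in> Sinf \<Longrightarrow> \<bar>f h\<bar> \<le> B"
    and "\<And>g h. g \<in> Sinf \<Longrightarrow> h \<in> Sinf \<Longrightarrow> (\<And>i. i < N \<Longrightarrow> g i = h i) \<Longrightarrow> f g = f h"
  shows "on_G f \<in> LUC"
proof (rule on_G_LUC_I[OF assms(1)])
  fix e :: real assume "e > 0"
  then show "\<exists>N. \<forall>g\<in>Sinf. \<forall>h\<in>Sinf. (\<forall>i<N. g i = h i) \<longrightarrow> \<bar>f g - f h\<bar> < e"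
    using assms(2) by (intro exI[of _ N]) (metis abs_zero cancel_comm_monoid_add_class.diff_cancel)
qed

text \<open>Bounded functions take their values in a compact part of \<open>K\<close>, where \<phi>
  is bounded and uniformly continuous. This treats sums, products and reciprocals at once;
  \<open>K\<close> is there for the reciprocal, which is continuous only away from 0.\<close>

lemma on_G_LUC_comp2:
  assumes f: "f \<in> LUC" "f' \<in> LUC"
    and K: "closed K" "\<And>h. h \<in> Sinf \<Longrightarrow> (f h, f' h) \<in> K"
    and \<phi>: "continuous_on K (\<lambda>(a, b). \<phi> a b)"
  shows "on_G (\<lambda>h. \<phi> (f h) (f' h) :: real) \<in> LUC"
proof -
  obtain B B' where B: "\<And>h. \<bar>f h\<bar> \<le> B" "\<And>h. \<bar>f' h\<bar> \<le> B'"
    using LUC_bounded[OF f(1)] LUC_bounded[OF f(2)] by metis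
  define K' where "K' = K \<inter> ({-B..B} \<times> {-B'..B'})"
  have K': "compact K'"
    unfolding K'_def by (intro closed_Int_compact K compact_Times compact_Icc)
  have in_K': "(f h, f' h) \<in> K'" if "h \<in> Sinf" for h
    using K(2)[OF that] B(1)[of h] B(2)[of h] by (auto simp: K'_def abs_le_iff)
  have cont: "continuous_on K' (\<lambda>(a, b). \<phi> a b)"
    using \<phi> by (rule continuous_on_subset) (auto simp: K'_def)
  have "bounded ((\<lambda>(a, b). \<phi> a b) ` K')"
    using compact_continuous_image[OF cont K'] by (rule compact_imp_bounded)
  then obtain C where C: "\<And>z. z \<in> K' \<Longrightarrow> \<bar>case z of (a, b) \<Rightarrow> \<phi> a b\<bar> \<le> C"
    unfolding bounded_iff by (metis imageI real_norm_def)
  show ?thesis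
  proof (rule on_G_LUC_I)
    show "\<bar>\<phi> (f h) (f' h)\<bar> \<le> C" if "h \<in> Sinf" for h
      using C[OF in_K'[OF that]] by simp
  next
    fix e :: real assume "e > 0"
    with compact_uniformly_continuous[OF cont K']
    obtain d where d: "d > 0" "\<And>z z'. z \<in> K' \<Longrightarrow> z' \<in> K' \<Longrightarrow> dist z' z < d \<Longrightarrow>
        dist (case z' of (a, b) \<Rightarrow> \<phi> a b) (case z of (a, b) \<Rightarrow> \<phi> a b) < e"
      unfolding uniformly_continuous_on_def by metis
    obtain N where N: "\<And>g h. g \<in> Sinf \<Longrightarrow> h \<in> Sinf \<Longrightarrow> (\<And>i. i < N \<Longrightarrow> g i = h i) \<Longrightarrow> \<bar>f g - f h\<bar> < d/2"
      using LUC_modulus[OF f(1), of "d/2"] d(1) by auto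
    obtain N' where N': "\<And>g h. g \<in> Sinf \<Longrightarrow> h \<in> Sinf \<Longrightarrow> (\<And>i. i < N' \<Longrightarrow> g i = h i) \<Longrightarrow> \<bar>f' g - f' h\<bar> < d/2"
      using LUC_modulus[OF f(2), of "d/2"] d(1) by auto
    have "\<bar>\<phi> (f g) (f' g) - \<phi> (f h) (f' h)\<bar> < e"
      if "g \<in> Sinf" "h \<in> Sinf" "\<forall>i<max N N'. g i = h i" for g h
    proof -
      have "\<bar>f g - f h\<bar> < d/2" "\<bar>f' g - f' h\<bar> < d/2"
        by (rule N N'; use that in simp)+
      then have "dist (f g, f' g) (f h, f' h) < d"
        using sqrt_sum_squares_le_sum_abs[of "f g - f h" "f' g - f' h"]
        by (simp add: dist_Pair_Pair dist_real_def)
      with in_K' that have "dist (\<phi> (f g) (f' g)) (\<phi> (f h) (f' h)) < e"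
        using d(2)[of "(f h, f' h)" "(f g, f' g)"] by simp
      then show ?thesis
        by (simp add: dist_real_def)
    qed
    then show "\<exists>N. \<forall>g\<in>Sinf. \<forall>h\<in>Sinf. (\<forall>i<N. g i = h i) \<longrightarrow> \<bar>\<phi> (f g) (f' g) - \<phi> (f h) (f' h)\<bar> < e"
      by blast
  qed
qed

lemma LUC_add: "f \<in> LUC \<Longrightarrow> f' \<in> LUC \<Longrightarrow> (\<lambda>h. f h + f' h) \<in> LUC"
proof -
  assume f: "f \<in> LUC" "f' \<in> LUC"
  have "on_G (\<lambda>h. f h + f' h) \<in> LUC"
    by (rule on_G_LUC_comp2[OF f, of UNIV]) (auto simp: case_prod_unfold intro!: continuous_intros)
  moreover have "on_G (\<lambda>h. f h + f' h) = (\<lambda>h. f h + f' h)"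
    using f by (auto simp: on_G_def LUC_outside)
  ultimately show ?thesis
    by simp
qed

lemma LUC_mult: "f \<in> LUC \<Longrightarrow> f' \<in> LUC \<Longrightarrow> (\<lambda>h. f h * f' h) \<in> LUC"
proof -
  assume f: "f \<in> LUC" "f' \<in> LUC"
  have "on_G (\<lambda>h. f h * f' h) \<in> LUC"
    by (rule on_G_LUC_comp2[OF f, of UNIV]) (auto simp: case_prod_unfold intro!: continuous_intros)
  moreover have "on_G (\<lambda>h. f h * f' h) = (\<lambda>h. f h * f' h)"
    using f by (auto simp: on_G_def LUC_outside)
  ultimately show ?thesis
    by simp
qed

lemma LUC_const: "on_G (\<lambda>_. c) \<in> LUC"
  by (rule on_G_LUC_cylinder[of _ "\<bar>c\<bar>" 0]) auto

lemma LUC_scale: "f \<in> LUC \<Longrightarrow> (\<lambda>h. c * f h) \<in> LUC"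
proof -
  assume f: "f \<in> LUC"
  have "(\<lambda>h. on_G (\<lambda>_. c) h * f h) = (\<lambda>h. c * f h)"
    using f by (auto simp: on_G_def LUC_outside)
  then show ?thesis
    using LUC_mult[OF LUC_const[of c] f] by simp
qed

lemma LUC_inverse:
  assumes f: "f \<in> LUC" and e: "e > 0" "\<And>h. h \<in> Sinf \<Longrightarrow> f h \<ge> e"
  shows "on_G (\<lambda>h. inverse (f h)) \<in> LUC"
proof (rule on_G_LUC_comp2[OF f f, where K = "{e..} \<times> UNIV" and \<phi> = "\<lambda>a _. inverse a"])
  show "continuous_on ({e..} \<times> UNIV) (\<lambda>(a, b). inverse a)"
    using e(1) by (auto simp: case_prod_unfold intro!: continuous_intros)
qed (use e in \<open>auto intro: closed_Times\<close>)


section \<open>Points of the Samuel compactification as ultrafilter limits\<close>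

lemma SG_outside: "p \<in> SG \<Longrightarrow> f \<notin> LUC \<Longrightarrow> p f = 0"
  and SG_one: "p \<in> SG \<Longrightarrow> p (on_G (\<lambda>_. 1)) = 1"
  and SG_add: "p \<in> SG \<Longrightarrow> f \<in> LUC \<Longrightarrow> f' \<in> LUC \<Longrightarrow> p (\<lambda>h. f h + f' h) = p f + p f'"
  and SG_mult: "p \<in> SG \<Longrightarrow> f \<in> LUC \<Longrightarrow> f' \<in> LUC \<Longrightarrow> p (\<lambda>h. f h * f' h) = p f * p f'"
  and SG_scale: "p \<in> SG \<Longrightarrow> f \<in> LUC \<Longrightarrow> p (\<lambda>h. c * f h) = c * p f"
  by (simp_all add: SG_def on_G_def)

text \<open>If the values \<open>p f\<close> could not be approximated simultaneously at a point of the group, then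
  \<open>\<Sum>(f - p f)\<^sup>2\<close> would be an invertible function in the kernel of the character \<open>p\<close>.\<close>

lemma SG_approx:
  assumes p: "p \<in> SG" and X: "finite X" "X \<subseteq> LUC" and e: "e > 0"
  shows "\<exists>g\<in>Sinf. \<forall>f\<in>X. \<bar>f g - p f\<bar> < e"
proof (rule ccontr)
  assume contra: "\<not> ?thesis"
  have "\<exists>S\<in>LUC. p S = 0 \<and> (\<forall>h\<in>Sinf. S h = (\<Sum>f\<in>X. (f h - p f)\<^sup>2))"
    using X
  proof (induction X)
    case empty
    have "p (\<lambda>h. 0 * on_G (\<lambda>_. 1) h) = 0 * p (on_G (\<lambda>_. 1))"
      by (intro SG_scale p LUC_const)
    then show ?case
      using LUC_scale[OF LUC_const[of 1], of 0] by (intro bexI[of _ "\<lambda>_. 0"]) auto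
  next
    case (insert f X)
    then obtain S where S: "S \<in> LUC" "p S = 0" "\<And>h. h \<in> Sinf \<Longrightarrow> S h = (\<Sum>f\<in>X. (f h - p f)\<^sup>2)"
      by auto
    have f: "f \<in> LUC"
      using insert.prems by simp
    let ?c = "\<lambda>h. - p f * on_G (\<lambda>_. 1) h"
    define d where "d = (\<lambda>h. f h + ?c h)"
    have c: "?c \<in> LUC"
      by (intro LUC_scale LUC_const)
    have d: "d \<in> LUC"
      unfolding d_def by (intro LUC_add f c)
    have "p ?c = - p f"
      using SG_scale[OF p LUC_const[of 1], of "- p f"] SG_one[OF p] by simp
    then have "p d = 0"
      unfolding d_def by (subst SG_add[OF p f c]) simp
    then have dd: "p (\<lambda>h. d h * d h) = 0"
      using SG_mult[OF p d d] by simp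
    show ?case
    proof (intro bexI conjI ballI)
      show "(\<lambda>h. S h + d h * d h) \<in> LUC"
        by (intro LUC_add LUC_mult S d)
      show "p (\<lambda>h. S h + d h * d h) = 0"
        using SG_add[OF p S(1) LUC_mult[OF d d]] S(2) dd by simp
      show "S h + d h * d h = (\<Sum>f\<in>insert f X. (f h - p f)\<^sup>2)" if "h \<in> Sinf" for h
        using that insert.hyps S(3)[OF that] by (simp add: d_def power2_eq_square)
    qed
  qed
  then obtain S where S: "S \<in> LUC" "p S = 0" "\<And>h. h \<in> Sinf \<Longrightarrow> S h = (\<Sum>f\<in>X. (f h - p f)\<^sup>2)"
    by auto
  have S_ge: "S h \<ge> e\<^sup>2" if h: "h \<in> Sinf" for h
  proof -
    obtain f where f: "f \<in> X" "\<not> \<bar>f h - p f\<bar> < e"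
      using contra h by auto
    have "e\<^sup>2 \<le> \<bar>f h - p f\<bar>\<^sup>2"
      using f(2) e by (intro power_mono) auto
    also have "\<dots> \<le> (\<Sum>f\<in>X. (f h - p f)\<^sup>2)"
      using member_le_sum[of f X "\<lambda>f. (f h - p f)\<^sup>2"] f(1) X(1) by simp
    finally show ?thesis
      by (simp add: S(3) h)
  qed
  let ?T = "on_G (\<lambda>h. inverse (S h))"
  have e2: "e\<^sup>2 > 0"
    using e by simp
  have T: "?T \<in> LUC"
    by (rule LUC_inverse[OF S(1) e2 S_ge])
  have "S h \<noteq> 0" if "h \<in> Sinf" for h
    using S_ge[OF that] e2 by linarith
  then have "S h * ?T h = on_G (\<lambda>_. 1) h" for h
    by (simp add: on_G_def)
  then have "p (on_G (\<lambda>_. 1)) = p S * p ?T"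
    using SG_mult[OF p S(1) T] by simp
  then show False
    using S(2) SG_one[OF p] by simp
qed

text \<open>By \<open>SG_approx\<close> the sets \<open>A (f, e)\<close> have the finite
  intersection property, and any ultrafilter containing them converges to \<open>p\<close>.
  Statements about characters thereby become statements about limits of group elements.\<close>

lemma SG_ultra:
  assumes p: "p \<in> SG"
  obtains U where "ultra U" "eventually (\<lambda>g. g \<in> Sinf) U" "\<And>f. f \<in> LUC \<Longrightarrow> (f \<longlongrightarrow> p f) U"
proof -
  define B where "B = LUC \<times> {0::real<..}"
  define A where "A = (\<lambda>(f, e). {g \<in> Sinf. \<bar>f g - p f\<bar> < e})"
  define F where "F = (INF b\<in>B. principal (A b))"
  have "F \<noteq> bot"
    unfolding F_def
  proof (rule INF_filter_not_bot)
    fix X assume X: "X \<subseteq> B" "finite X"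
    \<comment> \<open>The inserted 1 keeps the minimum meaningful when \<open>X\<close> is
      empty.\<close>
    define e where "e = Min (insert 1 (snd ` X))"
    have "e > 0"
      using X by (auto simp: e_def B_def)
    moreover have "fst ` X \<subseteq> LUC"
      using X(1) by (auto simp: B_def)
    ultimately obtain g where g: "g \<in> Sinf" "\<And>f. f \<in> fst ` X \<Longrightarrow> \<bar>f g - p f\<bar> < e"
      using SG_approx[OF p, of "fst ` X" e] X(2) by blast
    have "g \<in> A b" if "b \<in> X" for b
    proof -
      have "e \<le> snd b"
        using that X by (simp add: e_def)
      then show ?thesis
        using g(1) g(2)[of "fst b"] that by (auto simp: A_def case_prod_unfold)
    qed
    then have "\<Inter> (A ` X) \<noteq> {}"
      by blast
    then show "(INF b\<in>X. principal (A b)) \<noteq> bot"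
      using X(2) by (simp add: INF_principal_finite principal_eq_bot_iff)
  qed
  then obtain U where U: "U \<le> F" "ultra U"
    using ex_ultra_le by blast
  have ev: "eventually (\<lambda>g. g \<in> Sinf \<and> \<bar>f g - p f\<bar> < e) U" if "f \<in> LUC" "e > 0" for f e
  proof -
    have "F \<le> principal (A (f, e))"
      unfolding F_def by (rule INF_lower) (use that in \<open>auto simp: B_def\<close>)
    then have "U \<le> principal (A (f, e))"
      using U(1) by simp
    then show ?thesis
      by (simp add: le_principal A_def)
  qed
  have "eventually (\<lambda>g. g \<in> Sinf) U"
    using ev[OF LUC_const[of 0], of 1] by (auto elim: eventually_mono)
  moreover have "(f \<longlongrightarrow> p f) U" if "f \<in> LUC" for f
  proof (rule tendstoI)
    fix e :: real assume "e > 0"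
    then show "eventually (\<lambda>g. dist (f g) (p f) < e) U"
      using ev[OF that] by (simp add: eventually_conj_iff dist_real_def)
  qed
  ultimately show thesis
    using U(2) that by blast
qed

text \<open>A bound valid on the whole group survives the limit along an ultrafilter, so characters
  are contractive for the supremum norm.\<close>

lemma SG_dist_le:
  assumes p: "p \<in> SG" and f: "f \<in> LUC" "f' \<in> LUC"
    and le: "\<And>h. h \<in> Sinf \<Longrightarrow> \<bar>f h - f' h\<bar> \<le> e"
  shows "\<bar>p f - p f'\<bar> \<le> e"
proof -
  obtain U where U: "ultra U" "eventually (\<lambda>g. g \<in> Sinf) U" "\<And>f. f \<in> LUC \<Longrightarrow> (f \<longlongrightarrow> p f) U"
    using SG_ultra[OF p] by blast
  have "((\<lambda>h. \<bar>f h - f' h\<bar>) \<longlongrightarrow> \<bar>p f - p f'\<bar>) U"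
    by (intro tendsto_intros U f)
  moreover have "eventually (\<lambda>h. \<bar>f h - f' h\<bar> \<le> e) U"
    using U(2) le by (rule eventually_mono)
  ultimately show ?thesis
    using ultra_nontrivial[OF U(1)] by (metis tendsto_upperbound)
qed

definition ulim :: "perm filter \<Rightarrow> spt" where
  "ulim U = (\<lambda>f. if f \<in> LUC then Lim U f else 0)"

lemma ulim_tendsto:
  assumes U: "ultra U" and f: "f \<in> LUC"
  shows "(f \<longlongrightarrow> ulim U f) U"
proof -
  obtain B where B: "\<And>h. \<bar>f h\<bar> \<le> B"
    using LUC_bounded[OF f] by blast
  have "\<exists>l\<in>{-B..B}. (f \<longlongrightarrow> l) U"
  proof (rule ultra_convergent[OF U])
    show "eventually (\<lambda>h. f h \<in> {-B..B}) U"
      using B by (auto simp: abs_le_iff intro!: always_eventually) (metis neg_le_iff_le minus_le_iff)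
  qed simp
  then show ?thesis
    using f tendsto_Lim[OF ultra_nontrivial[OF U]] by (auto simp: ulim_def)
qed

lemma ulim_eqI:
  assumes "ultra U" "f \<in> LUC" "(f \<longlongrightarrow> l) U"
  shows "ulim U f = l"
  using assms tendsto_unique[OF ultra_nontrivial] ulim_tendsto by blast

lemma ulim_SG:
  assumes U: "ultra U" and ev: "eventually (\<lambda>g. g \<in> Sinf) U"
  shows "ulim U \<in> SG"
proof -
  have "ulim U (on_G (\<lambda>_. 1)) = 1"
  proof (rule ulim_eqI[OF U LUC_const])
    show "(on_G (\<lambda>_. 1) \<longlongrightarrow> 1) U"
      by (rule tendsto_eventually) (use ev in \<open>auto elim: eventually_mono\<close>)
  qed
  moreover have "ulim U (\<lambda>h. f h + f' h) = ulim U f + ulim U f'"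
    and "ulim U (\<lambda>h. f h * f' h) = ulim U f * ulim U f'" if "f \<in> LUC" "f' \<in> LUC" for f f'
    using that by (auto intro!: ulim_eqI U LUC_add LUC_mult tendsto_intros ulim_tendsto)
  moreover have "ulim U (\<lambda>h. c * f h) = c * ulim U f" if "f \<in> LUC" for f c
    using that by (auto intro!: ulim_eqI U LUC_scale tendsto_intros ulim_tendsto)
  ultimately show ?thesis
    by (auto simp: SG_def on_G_def) (auto simp: ulim_def)
qed


section \<open>The semigroup\<close>

definition shift :: "gfun \<Rightarrow> perm \<Rightarrow> gfun" where
  "shift f g = on_G (\<lambda>h. f (h \<circ> g))"

definition translates :: "spt \<Rightarrow> gfun \<Rightarrow> gfun" where
  "translates p f = on_G (\<lambda>h. p (shift f h))"

text \<open>An explicit form of the semigroup product: the limit of \<open>f (h \<circ> g)\<close>,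
  first as \<open>h\<close> tends to \<open>p\<close> and then as \<open>g\<close> tends to
  \<open>q\<close>. It replaces the description of \<open>sg_lambda\<close> by unique
  existence.\<close>

definition mul :: "spt \<Rightarrow> spt \<Rightarrow> spt" where
  "mul p q = (\<lambda>f. if f \<in> LUC then q (translates p f) else 0)"

lemma on_G_cong: "(\<And>h. h \<in> Sinf \<Longrightarrow> f h = f' h) \<Longrightarrow> on_G f = on_G f'"
  by (auto simp: on_G_def)

lemma on_G_LUC_eq: "f \<in> LUC \<Longrightarrow> on_G f = f"
  by (auto simp: on_G_def LUC_outside)

lemma shift_apply: "h \<in> Sinf \<Longrightarrow> shift f g h = f (h \<circ> g)"
  by (simp add: shift_def)

lemma translates_apply: "h \<in> Sinf \<Longrightarrow> translates p f h = p (shift f h)"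
  by (simp add: translates_def)

lemma mul_apply: "f \<in> LUC \<Longrightarrow> mul p q f = q (translates p f)"
  by (simp add: mul_def)

lemma sg_act_apply: "f \<in> LUC \<Longrightarrow> sg_act p g f = p (shift f g)"
  by (simp add: sg_act_def shift_def on_G_def)

lemma shift_LUC:
  assumes f: "f \<in> LUC" and g: "g \<in> Sinf"
  shows "shift f g \<in> LUC"
proof -
  obtain B where B: "\<And>h. \<bar>f h\<bar> \<le> B"
    using LUC_bounded[OF f] by blast
  show ?thesis
    unfolding shift_def
  proof (rule on_G_LUC_I)
    fix e :: real assume "e > 0"
    then obtain N where N: "\<And>g h. g \<in> Sinf \<Longrightarrow> h \<in> Sinf \<Longrightarrow> (\<And>i. i < N \<Longrightarrow> g i = h i) \<Longrightarrow> \<bar>f g - f h\<bar> < e"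
      using LUC_modulus[OF f] by blast
    \<comment> \<open>Agreement of \<open>h \<circ> g\<close> and \<open>h' \<circ> g\<close> below
      \<open>N\<close> follows from agreement of \<open>h\<close> and \<open>h'\<close> on the image
      of \<open>{..<N}\<close> under \<open>g\<close>.\<close>
    obtain N' where N': "\<And>i. i < N \<Longrightarrow> g i < N'"
      using finite_nat_set_iff_bounded[of "g ` {..<N}"] by auto
    have "\<bar>f (h \<circ> g) - f (h' \<circ> g)\<bar> < e" if "h \<in> Sinf" "h' \<in> Sinf" "\<forall>i<N'. h i = h' i" for h h'
      using that N' g by (intro N) auto
    then show "\<exists>N. \<forall>h\<in>Sinf. \<forall>h'\<in>Sinf. (\<forall>i<N. h i = h' i) \<longrightarrow> \<bar>f (h \<circ> g) - f (h' \<circ> g)\<bar> < e"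
      by blast
  qed (rule B)
qed

lemma shift_shift: "g \<in> Sinf \<Longrightarrow> shift (shift f h) g = shift f (g \<circ> h)"
  unfolding shift_def by (rule on_G_cong) (simp add: comp_assoc)

text \<open>Commuting with right translations is what makes \<open>mul p\<close> equivariant and
  \<open>mul\<close> associative.\<close>

lemma translates_shift: "g \<in> Sinf \<Longrightarrow> translates p (shift f g) = shift (translates p f) g"
  unfolding translates_def[of p "shift f g"] shift_def[of "translates p f"]
  by (rule on_G_cong) (simp add: shift_shift translates_apply)

lemma SG_abs_le:
  assumes p: "p \<in> SG" and f: "f \<in> LUC" and le: "\<And>h. h \<in> Sinf \<Longrightarrow> \<bar>f h\<bar> \<le> B"
  shows "\<bar>p f\<bar> \<le> B"
proof -
  have "p (\<lambda>h. 0 * f h) = 0"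
    using SG_scale[OF p f, of 0] by simp
  then show ?thesis
    using SG_dist_le[OF p f LUC_scale[OF f, of 0], of B] le by simp
qed

text \<open>If \<open>g\<close> and \<open>h\<close> agree below \<open>N\<close>, so do
  \<open>k \<circ> g\<close> and \<open>k \<circ> h\<close>, uniformly in \<open>k\<close>;
  contractivity of \<open>p\<close> carries the uniform bound over.\<close>

lemma translates_LUC:
  assumes p: "p \<in> SG" and f: "f \<in> LUC"
  shows "translates p f \<in> LUC"
proof -
  obtain B where B: "\<And>h. \<bar>f h\<bar> \<le> B"
    using LUC_bounded[OF f] by blast
  show ?thesis
    unfolding translates_def
  proof (rule on_G_LUC_I)
    show "\<bar>p (shift f h)\<bar> \<le> B" if "h \<in> Sinf" for h
      by (rule SG_abs_le[OF p shift_LUC[OF f that]]) (simp add: shift_apply B)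
  next
    fix e :: real assume e: "e > 0"
    \<comment> \<open>Half of \<open>e\<close>, because passing to the limit turns a strict bound
      into a weak one.\<close>
    obtain N where N: "\<And>g h. g \<in> Sinf \<Longrightarrow> h \<in> Sinf \<Longrightarrow> (\<And>i. i < N \<Longrightarrow> g i = h i) \<Longrightarrow> \<bar>f g - f h\<bar> < e/2"
      using LUC_modulus[OF f, of "e/2"] e by auto
    have "\<bar>p (shift f g) - p (shift f h)\<bar> < e" if "g \<in> Sinf" "h \<in> Sinf" "\<forall>i<N. g i = h i" for g h
    proof -
      have "\<bar>shift f g k - shift f h k\<bar> \<le> e/2" if "k \<in> Sinf" for k
      proof -
        have "\<bar>f (k \<circ> g) - f (k \<circ> h)\<bar> < e/2"
          using \<open>g \<in> Sinf\<close> \<open>h \<in> Sinf\<close> \<open>\<forall>i<N. g i = h i\<close> that by (intro N) auto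
        then show ?thesis
          using that by (simp add: shift_apply)
      qed
      then have "\<bar>p (shift f g) - p (shift f h)\<bar> \<le> e/2"
        by (rule SG_dist_le[OF p shift_LUC[OF f that(1)] shift_LUC[OF f that(2)]])
      then show ?thesis
        using e by linarith
    qed
    then show "\<exists>N. \<forall>g\<in>Sinf. \<forall>h\<in>Sinf. (\<forall>i<N. g i = h i) \<longrightarrow> \<bar>p (shift f g) - p (shift f h)\<bar> < e"
      by blast
  qed
qed

text \<open>\<open>translates p\<close> is a unital algebra homomorphism of \<open>LUC\<close>, so
  composing it with a character gives a character.\<close>

lemma mul_SG:
  assumes p: "p \<in> SG" and q: "q \<in> SG"
  shows "mul p q \<in> SG"
proof -
  have one: "translates p (on_G (\<lambda>_. 1)) = on_G (\<lambda>_. 1)"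
  proof -
    have "shift (on_G (\<lambda>_. 1)) h = on_G (\<lambda>_. 1)" if "h \<in> Sinf" for h
      using that by (auto simp: shift_def on_G_def)
    then show ?thesis
      by (auto simp: translates_def on_G_def SG_one[OF p, unfolded on_G_def])
  qed
  have lin: "translates p (\<lambda>h. f h + f' h) = (\<lambda>h. translates p f h + translates p f' h)"
    and mult: "translates p (\<lambda>h. f h * f' h) = (\<lambda>h. translates p f h * translates p f' h)"
    if f: "f \<in> LUC" "f' \<in> LUC" for f f'
  proof -
    have "shift (\<lambda>h. f h + f' h) g = (\<lambda>h. shift f g h + shift f' g h)"
      and "shift (\<lambda>h. f h * f' h) g = (\<lambda>h. shift f g h * shift f' g h)" for g
      by (auto simp: shift_def on_G_def)
    then show "translates p (\<lambda>h. f h + f' h) = (\<lambda>h. translates p f h + translates p f' h)"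
      and "translates p (\<lambda>h. f h * f' h) = (\<lambda>h. translates p f h * translates p f' h)"
      by (auto simp: translates_def on_G_def SG_add[OF p] SG_mult[OF p] shift_LUC f)
  qed
  have scale: "translates p (\<lambda>h. c * f h) = (\<lambda>h. c * translates p f h)" if f: "f \<in> LUC" for f c
  proof -
    have "shift (\<lambda>h. c * f h) g = (\<lambda>h. c * shift f g h)" for g
      by (auto simp: shift_def on_G_def)
    then show ?thesis
      by (auto simp: translates_def on_G_def SG_scale[OF p] shift_LUC f)
  qed
  have "mul p q (on_G (\<lambda>_. 1)) = 1"
    by (simp add: mul_apply LUC_const one SG_one[OF q])
  then show ?thesis
    by (auto simp: SG_def mul_def LUC_add LUC_mult LUC_scale lin mult scale
        SG_add[OF q] SG_mult[OF q] SG_scale[OF q] translates_LUC[OF p] on_G_def[symmetric])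
qed

lemma translates_mul:
  assumes f: "f \<in> LUC"
  shows "translates (mul p q) f = translates q (translates p f)"
  unfolding translates_def[of "mul p q"] translates_def[of q]
  by (rule on_G_cong) (simp add: f mul_apply shift_LUC translates_shift)

lemma mul_assoc:
  assumes "p \<in> SG" "q \<in> SG"
  shows "mul (mul p q) r = mul p (mul q r)"
proof
  fix f
  show "mul (mul p q) r f = mul p (mul q r) f"
  proof (cases "f \<in> LUC")
    case True
    then show ?thesis
      using translates_LUC[OF assms(1) True] by (simp add: mul_apply translates_mul)
  qed (simp add: mul_def)
qed

lemma sg_one_SG: "sg_one \<in> SG"
  by (auto simp: SG_def sg_one_def LUC_add LUC_mult LUC_scale LUC_const on_G_def[symmetric])

lemma sg_act_one_apply: "f \<in> LUC \<Longrightarrow> g \<in> Sinf \<Longrightarrow> sg_act sg_one g f = f g"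
  by (simp add: sg_act_apply sg_one_def shift_LUC shift_apply)

lemma mul_sg_act:
  assumes "p \<in> SG" "g \<in> Sinf"
  shows "mul p (sg_act q g) = sg_act (mul p q) g"
proof
  fix f
  show "mul p (sg_act q g) f = sg_act (mul p q) g f"
  proof (cases "f \<in> LUC")
    case True
    then show ?thesis
      using assms by (simp add: mul_apply sg_act_apply translates_LUC shift_LUC translates_shift)
  qed (simp add: mul_def sg_act_def)
qed

lemma shift_id: "f \<in> LUC \<Longrightarrow> shift f id = f"
  by (simp add: shift_def on_G_LUC_eq)

lemma mul_one_right:
  assumes "p \<in> SG"
  shows "mul p sg_one = p"
proof
  fix f
  show "mul p sg_one f = p f"
    using assms by (cases "f \<in> LUC")
      (auto simp: mul_def sg_one_def translates_LUC translates_apply shift_id SG_outside)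
qed

text \<open>Evaluation at \<open>g\<close> is a character, and \<open>p g\<close> is its product
  with \<open>p\<close> on the left.\<close>

lemma sg_act_SG:
  assumes "p \<in> SG" "g \<in> Sinf"
  shows "sg_act p g \<in> SG"
proof -
  have "sg_act sg_one g \<in> SG"
    using assms by (auto simp: SG_def sg_act_one_apply LUC_add LUC_mult LUC_scale LUC_const
        on_G_def[symmetric]) (simp add: sg_act_def)
  then have "mul p (sg_act sg_one g) \<in> SG"
    by (intro mul_SG assms)
  then show ?thesis
    using assms by (simp add: mul_sg_act mul_one_right)
qed

text \<open>Coordinate \<open>f\<close> of the product is the single coordinate
  \<open>translates p f\<close> of the right factor.\<close>

lemma continuous_on_mul: "continuous_on S (mul p)"
proof (rule continuous_on_coordinatewise_then_product)
  fix f
  have "continuous_on S (\<lambda>q :: spt. q (translates p f))"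
    by (rule continuous_on_subset[OF continuous_on_product_coordinates]) simp
  then show "continuous_on S (\<lambda>q. mul p q f)"
    by (cases "f \<in> LUC") (auto simp: mul_def)
qed

lemma continuous_on_sg_act: "continuous_on S (\<lambda>p. sg_act p g)"
proof (rule continuous_on_coordinatewise_then_product)
  fix f
  have "continuous_on S (\<lambda>q :: spt. q (shift f g))"
    by (rule continuous_on_subset[OF continuous_on_product_coordinates]) simp
  then show "continuous_on S (\<lambda>q. sg_act q g f)"
    by (cases "f \<in> LUC") (auto simp: sg_act_def shift_def on_G_def)
qed

section \<open>Density of the group, and equivariant maps as left multiplications\<close>

lemma SG_dense:
  assumes C: "closedin (top_of_set SG) C" and G: "\<And>g. g \<in> Sinf \<Longrightarrow> sg_act sg_one g \<in> C"
    and p: "p \<in> SG"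
  shows "p \<in> C"
proof -
  obtain U where U: "ultra U" "eventually (\<lambda>g. g \<in> Sinf) U" "\<And>f. f \<in> LUC \<Longrightarrow> (f \<longlongrightarrow> p f) U"
    using SG_ultra[OF p] by blast
  obtain T where T: "closed T" "C = SG \<inter> T"
    using C by (auto simp: closedin_closed)
  \<comment> \<open>On \<open>LUC\<close> the translate of 1 by \<open>g\<close> is evaluation at
    \<open>g\<close>, which tends to \<open>p\<close>; off \<open>LUC\<close> both sides are
    0.\<close>
  have "((\<lambda>g. sg_act sg_one g f) \<longlongrightarrow> p f) U" for f
  proof (cases "f \<in> LUC")
    case True
    then have "eventually (\<lambda>g. f g = sg_act sg_one g f) U"
      using U(2) by (auto simp: sg_act_one_apply elim: eventually_mono)
    then show ?thesis
      using U(3)[OF True] by (rule Lim_transform_eventually[rotated])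
  next
    case False
    then show ?thesis
      using SG_outside[OF p] by (simp add: sg_act_def)
  qed
  then have "limitin (product_topology (\<lambda>_. euclidean) UNIV) (\<lambda>g. sg_act sg_one g) p U"
    by (simp add: limitin_componentwise)
  then have "((\<lambda>g. sg_act sg_one g) \<longlongrightarrow> p) U"
    by (simp add: euclidean_product_topology)
  moreover have "eventually (\<lambda>g. sg_act sg_one g \<in> T) U"
    using U(2) G T(2) by (auto elim: eventually_mono)
  ultimately have "p \<in> T"
    using T(1) ultra_nontrivial[OF U(1)] by (metis Lim_in_closed_set)
  then show ?thesis
    using p T(2) by simp
qed

text \<open>Both sides are continuous and equivariant and agree at 1, hence on its dense orbit.
  Agreement is tested one coordinate at a time, where it is a closed condition.\<close>

lemma equivariant_eq_mul:
  assumes l: "continuous_on SG l" "l ` SG \<subseteq> SG" "sg_equivariant l" and p: "p \<in> SG"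
  shows "l p = mul (l sg_one) p"
proof
  fix f
  have u: "l sg_one \<in> SG"
    using l(2) sg_one_SG by blast
  let ?C = "{q \<in> SG. l q f - mul (l sg_one) q f = 0}"
  have "continuous_on SG (\<lambda>q. l q f - mul (l sg_one) q f)"
    using continuous_on_product_then_coordinatewise[OF l(1)]
      continuous_on_product_then_coordinatewise[OF continuous_on_mul]
    by (intro continuous_on_diff)
  then have "closedin (top_of_set SG) ?C"
    by (rule continuous_closedin_preimage_constant)
  moreover have "sg_act sg_one g \<in> ?C" if "g \<in> Sinf" for g
    using that l(3) sg_one_SG u
    by (simp add: sg_equivariant_def sg_act_SG mul_sg_act mul_one_right)
  ultimately have "p \<in> ?C"
    using p by (rule SG_dense)
  then show "l p f = mul (l sg_one) p f"
    by simp
qed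

lemma sg_mult_eq_mul:
  assumes x: "x \<in> SG" and y: "y \<in> SG"
  shows "sg_mult x y = mul x y"
proof -
  \<comment> \<open>The value \<open>undefined\<close> off \<open>SG\<close> matches the
    extensionality clause of \<open>sg_lambda\<close>, which makes its description unique.\<close>
  define l where "l p = (if p \<in> SG then mul x p else undefined)" for p
  have "sg_lambda x = l"
    unfolding sg_lambda_def
  proof (rule the_equality)
    have "continuous_on SG l"
      using continuous_on_mul by (rule continuous_on_cong[THEN iffD1, rotated -1]) (auto simp: l_def)
    then show "continuous_on SG l \<and> l ` SG \<subseteq> SG \<and> sg_equivariant l \<and> l sg_one = x \<and>
        (\<forall>p. p \<notin> SG \<longrightarrow> l p = undefined)"
      using x by (auto simp: l_def mul_SG sg_equivariant_def sg_act_SG mul_sg_act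
          mul_one_right sg_one_SG)
  next
    fix k
    assume k: "continuous_on SG k \<and> k ` SG \<subseteq> SG \<and> sg_equivariant k \<and> k sg_one = x \<and>
        (\<forall>p. p \<notin> SG \<longrightarrow> k p = undefined)"
    show "k = l"
    proof
      fix p
      show "k p = l p"
        using k equivariant_eq_mul[of k p] by (cases "p \<in> SG") (auto simp: l_def)
    qed
  qed
  then show ?thesis
    using y by (simp add: sg_mult_def l_def)
qed

section \<open>The smallest ideal, minimal subflows and retractions\<close>

lemma in_KSG:
  assumes x: "x \<in> SG" and rec: "\<And>w. w \<in> SG \<Longrightarrow> \<exists>v\<in>SG. mul (mul x w) v = x"
  shows "x \<in> KSG"
proof -
  \<comment> \<open>If \<open>j\<close> lies in an ideal, then so does \<open>x = (x j) v\<close>.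
    Every ideal thus contains \<open>x\<close> and with it \<open>K\<close>, which exhibits the
    smallest ideal that \<open>KSG\<close> describes.\<close>
  define K where "K = {mul a (mul x b) | a b. a \<in> SG \<and> b \<in> SG}"
  have in_J: "x \<in> J" if J: "sg_ideal J" for J
  proof -
    obtain j where j: "j \<in> J" "j \<in> SG"
      using J by (auto simp: sg_ideal_def)
    then obtain v where v: "v \<in> SG" "mul (mul x j) v = x"
      using rec by blast
    have "mul x j \<in> J" "mul x j \<in> SG"
      using J j x sg_mult_eq_mul[OF x j(2)] unfolding sg_ideal_def by (metis, simp add: mul_SG)
    then have "mul (mul x j) v \<in> J"
      using J v sg_mult_eq_mul[of "mul x j" v] unfolding sg_ideal_def by metis
    then show ?thesis
      using v by simp
  qed
  have "sg_ideal K"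
    unfolding sg_ideal_def
  proof (intro conjI ballI)
    show "K \<noteq> {}" "K \<subseteq> SG"
      using x sg_one_SG by (auto simp: K_def mul_SG)
  next
    fix c z assume c: "c \<in> SG" and "z \<in> K"
    then obtain a b where z: "z = mul a (mul x b)" "a \<in> SG" "b \<in> SG"
      by (auto simp: K_def)
    have "mul c z = mul (mul c a) (mul x b)"
      using z c x by (simp add: mul_assoc mul_SG)
    then have "mul c z \<in> K"
      unfolding K_def using mul_SG[OF c z(2)] z(3) by blast
    then show "sg_mult c z \<in> K"
      using z c x by (simp add: sg_mult_eq_mul mul_SG)
    have "mul z c = mul a (mul x (mul b c))"
      using z c x by (simp add: mul_assoc mul_SG)
    then have "mul z c \<in> K"
      unfolding K_def using mul_SG[OF z(3) c] z(2) by blast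
    then show "sg_mult z c \<in> K"
      using z c x by (simp add: sg_mult_eq_mul mul_SG)
  qed
  moreover have "K \<subseteq> J" if J: "sg_ideal J" for J
  proof
    fix z assume "z \<in> K"
    then obtain a b where z: "z = mul a (mul x b)" "a \<in> SG" "b \<in> SG"
      by (auto simp: K_def)
    have "mul x b \<in> J"
      using in_J[OF J] J z x sg_mult_eq_mul[of x b] unfolding sg_ideal_def by metis
    then show "z \<in> J"
      using J z x sg_mult_eq_mul[of a "mul x b"] unfolding sg_ideal_def by (metis mul_SG)
  qed
  ultimately have "KSG = K"
    unfolding KSG_def by (intro the_equality) auto
  then show ?thesis
    using in_J[OF \<open>sg_ideal K\<close>] by simp
qed

text \<open>By minimality the orbit of \<open>z\<close> is dense in \<open>M\<close>. An ultrafilter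
  of group elements driving \<open>z g\<close> to \<open>u\<close> has a limit \<open>w\<close> in
  S(G), and \<open>z w = u\<close>.\<close>

lemma minimal_subflow_eq_mul:
  assumes M: "sg_minimal_subflow M" and z: "z \<in> M" and u: "u \<in> M"
  obtains w where "w \<in> SG" "u = mul z w"
proof -
  have sub: "M \<subseteq> SG" and inv: "\<And>p g. p \<in> M \<Longrightarrow> g \<in> Sinf \<Longrightarrow> sg_act p g \<in> M"
    and closed: "closedin (top_of_set SG) M"
    and minimal: "\<And>N. sg_subflow N \<Longrightarrow> N \<subseteq> M \<Longrightarrow> N = M"
    using M by (auto simp: sg_minimal_subflow_def sg_subflow_def)
  have z_SG: "z \<in> SG" and u_SG: "u \<in> SG"
    using z u sub by auto
  define orb where "orb = sg_act z ` Sinf"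
  define N where "N = SG \<inter> closure orb"
  have orb: "orb \<subseteq> SG" "orb \<subseteq> M"
    using z z_SG inv by (auto simp: orb_def sg_act_SG)
  have orb_act: "sg_act p g \<in> orb" if "p \<in> orb" "g \<in> Sinf" for p g
  proof -
    obtain h where h: "h \<in> Sinf" "p = sg_act z h"
      using \<open>p \<in> orb\<close> unfolding orb_def by blast
    have "sg_act p g = sg_act z (h \<circ> g)"
    proof
      fix f
      show "sg_act p g f = sg_act z (h \<circ> g) f"
      proof (cases "f \<in> LUC")
        case True
        have "shift (shift f g) h = shift f (h \<circ> g)"
          by (rule shift_shift) (rule h)
        then show ?thesis
          using True that h by (simp add: sg_act_apply shift_LUC)
      qed (simp add: sg_act_def)
    qed
    then show ?thesis
      using that h by (auto simp: orb_def)
  qed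
  have "sg_subflow N"
    unfolding sg_subflow_def
  proof (intro conjI ballI)
    have "orb \<noteq> {}"
      using Sinf_id unfolding orb_def by blast
    then show "N \<noteq> {}"
      using orb closure_subset[of orb] by (auto simp: N_def)
    show "N \<subseteq> SG" "closedin (top_of_set SG) N"
      by (auto simp: N_def closedin_closed)
  next
    fix p g assume p: "p \<in> N" and g: "g \<in> Sinf"
    have "(\<lambda>p. sg_act p g) ` closure orb \<subseteq> closure orb"
      using continuous_on_sg_act
      by (rule image_closure_subset) (use orb_act g closure_subset[of orb] in auto)
    then show "sg_act p g \<in> N"
      using p g by (auto simp: N_def sg_act_SG)
  qed
  moreover have "N \<subseteq> M"
  proof -
    obtain T where T: "closed T" "M = SG \<inter> T"
      using closed by (auto simp: closedin_closed)
    then have "closure orb \<subseteq> T"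
      using orb by (intro closure_minimal) auto
    then show ?thesis
      using T by (auto simp: N_def)
  qed
  ultimately have "u \<in> closure orb"
    using minimal u by (auto simp: N_def)
  \<comment> \<open>Generated by the sets of permutations moving \<open>z\<close> into a
    neighbourhood of \<open>u\<close>; it is proper because \<open>u\<close> lies in the closure of
    the orbit.\<close>
  define F where "F = inf (filtercomap (sg_act z) (nhds u)) (principal Sinf)"
  have "F \<noteq> bot"
  proof
    assume "F = bot"
    then have "eventually (\<lambda>g. g \<notin> Sinf) (filtercomap (sg_act z) (nhds u))"
      by (simp add: F_def trivial_limit_def eventually_inf_principal)
    then obtain S where S: "open S" "u \<in> S" "\<And>g. sg_act z g \<in> S \<Longrightarrow> g \<notin> Sinf"
      by (auto simp: eventually_filtercomap eventually_nhds)
    then have "S \<inter> orb = {}"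
      by (auto simp: orb_def)
    then show False
      using S \<open>u \<in> closure orb\<close> by (meson closure_iff_nhds_not_empty disjoint_iff open_subset subset_refl)
  qed
  then obtain U where U: "U \<le> F" "ultra U"
    using ex_ultra_le by blast
  have ev: "eventually (\<lambda>g. g \<in> Sinf) U"
    using U(1) by (simp add: F_def le_principal)
  have lim: "(sg_act z \<longlongrightarrow> u) U"
    using U(1) by (simp add: F_def filterlim_iff_le_filtercomap)
  have "u = mul z (ulim U)"
  proof
    fix f
    show "u f = mul z (ulim U) f"
    proof (cases "f \<in> LUC")
      case True
      have "limitin (product_topology (\<lambda>_. euclidean) UNIV) (sg_act z) u U"
        using lim by (simp add: euclidean_product_topology)
      then have "((\<lambda>g. sg_act z g f) \<longlongrightarrow> u f) U"
        by (simp add: limitin_componentwise)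
      moreover have "eventually (\<lambda>g. sg_act z g f = translates z f g) U"
        using ev by (rule eventually_mono) (simp add: True sg_act_apply translates_apply)
      ultimately have "(translates z f \<longlongrightarrow> u f) U"
        by (rule Lim_transform_eventually)
      then have "ulim U (translates z f) = u f"
        using ulim_eqI[OF U(2) translates_LUC[OF z_SG True]] by blast
      then show ?thesis
        using True by (simp add: mul_apply)
    qed (simp add: mul_def SG_outside[OF u_SG])
  qed
  then show thesis
    using that ulim_SG[OF U(2) ev] by blast
qed

lemma retraction_identifies:
  assumes x: "x \<in> SG" and y: "y \<in> SG"
    and eq: "\<And>w. w \<in> SG \<Longrightarrow> mul x (mul w x) = mul x (mul w y)"
    and M: "sg_minimal_subflow M" and \<phi>: "sg_retraction M \<phi>"
  shows "\<phi> x = \<phi> y"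
proof -
  define u where "u = \<phi> sg_one"
  have M_SG: "M \<subseteq> SG"
    using M by (auto simp: sg_minimal_subflow_def sg_subflow_def)
  have \<phi>': "continuous_on SG \<phi>" "\<phi> ` SG \<subseteq> M" "sg_equivariant \<phi>"
    using \<phi> by (auto simp: sg_retraction_def)
  then have u: "u \<in> M" "u \<in> SG"
    using M_SG sg_one_SG by (auto simp: u_def)
  have \<phi>_eq: "\<phi> p = mul u p" if "p \<in> SG" for p
    using equivariant_eq_mul[of \<phi> p] \<phi>' M_SG that by (auto simp: u_def)
  have "mul u x \<in> M"
    using \<phi>_eq[OF x] \<phi>'(2) x by auto
  then obtain w where w: "w \<in> SG" "u = mul (mul u x) w"
    using minimal_subflow_eq_mul[OF M _ u(1)] by blast
  have "mul u p = mul u (mul x (mul w p))" if "p \<in> SG" for p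
    using w u x that by (metis mul_SG mul_assoc)
  then show ?thesis
    using eq[OF w(1)] x y \<phi>_eq by simp
qed


section \<open>The order at a point\<close>

definition inc :: "nat \<Rightarrow> nat \<Rightarrow> gfun" where
  "inc a b = on_G (\<lambda>k. if k a < k b then 1 else 0)"

text \<open>The values of the character \<open>p\<close> on the idempotent \<open>inc a b\<close> are \<open>0\<close> and \<open>1\<close>; \<open>lt p\<close> is the
  image of \<open>p\<close> in the flow of linear orders on \<open>nat\<close>.\<close>

definition lt :: "spt \<Rightarrow> nat \<Rightarrow> nat \<Rightarrow> bool" where
  "lt p a b \<longleftrightarrow> p (inc a b) = 1"

lemma inc_LUC: "inc a b \<in> LUC"
  unfolding inc_def by (rule on_G_LUC_cylinder[of _ 1 "Suc (max a b)"]) auto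

text \<open>Translating the argument pair by \<open>h\<close> is how the action on S(G) becomes the
  action on linear orders.\<close>

lemma shift_inc: "h \<in> Sinf \<Longrightarrow> shift (inc a b) h = inc (h a) (h b)"
  unfolding shift_def inc_def by (rule on_G_cong) simp

lemma inc_limit:
  assumes U: "ultra U" "eventually (\<lambda>g. g \<in> Sinf) U" and l: "(inc a b \<longlongrightarrow> l) U"
  shows "l = (if eventually (\<lambda>g. g a < g b) U then 1 else 0)"
proof (cases "eventually (\<lambda>g. g a < g b) U")
  case True
  then have "eventually (\<lambda>g. inc a b g = 1) U"
    using U(2) by eventually_elim (simp add: inc_def)
  then have "(inc a b \<longlongrightarrow> 1) U"
    by (rule tendsto_eventually)
  then show ?thesis
    using l tendsto_unique[OF ultra_nontrivial[OF U(1)]] True by auto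
next
  case False
  then have "eventually (\<lambda>g. \<not> g a < g b) U"
    using ultra_eventually_not[OF U(1)] by blast
  then have "eventually (\<lambda>g. inc a b g = 0) U"
    using U(2) by eventually_elim (simp add: inc_def)
  then have "(inc a b \<longlongrightarrow> 0) U"
    by (rule tendsto_eventually)
  then show ?thesis
    using l tendsto_unique[OF ultra_nontrivial[OF U(1)]] False by auto
qed

lemma SG_inc_ultra:
  assumes U: "ultra U" "eventually (\<lambda>g. g \<in> Sinf) U" and lim: "\<And>f. f \<in> LUC \<Longrightarrow> (f \<longlongrightarrow> p f) U"
  shows "eventually (\<lambda>g. g a < g b \<longleftrightarrow> lt p a b) U"
    and "p (inc a b) = (if lt p a b then 1 else 0)"
proof -
  have *: "p (inc a b) = (if eventually (\<lambda>g. g a < g b) U then 1 else 0)"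
    by (rule inc_limit[OF U lim[OF inc_LUC]])
  then show "p (inc a b) = (if lt p a b then 1 else 0)"
    by (simp add: lt_def)
  show "eventually (\<lambda>g. g a < g b \<longleftrightarrow> lt p a b) U"
    using * ultra_eventually_not[OF U(1), of "\<lambda>g. g a < g b"] by (auto simp: lt_def split: if_splits)
qed

lemma SG_inc:
  assumes p: "p \<in> SG"
  shows "p (inc a b) = (if lt p a b then 1 else 0)"
  using SG_ultra[OF p] SG_inc_ultra(2) by metis

lemma SG_order_ultra:
  assumes U: "ultra U" "eventually (\<lambda>g. g \<in> Sinf) U" and lim: "\<And>f. f \<in> LUC \<Longrightarrow> (f \<longlongrightarrow> p f) U"
    and A: "finite A"
  shows "eventually (\<lambda>g. \<forall>a\<in>A. \<forall>b\<in>A. g a < g b \<longleftrightarrow> lt p a b) U"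
  using A by (intro eventually_ball_finite ballI SG_inc_ultra(1) U lim)

text \<open>On a finite set \<open>lt p\<close> is the pullback of the usual order by a permutation,
  so its order axioms can be read off from \<open>nat\<close> whenever finitely many points are
  involved.\<close>

lemma SG_order:
  assumes p: "p \<in> SG" and A: "finite A"
  obtains g where "g \<in> Sinf" "\<And>a b. a \<in> A \<Longrightarrow> b \<in> A \<Longrightarrow> g a < g b \<longleftrightarrow> lt p a b"
proof -
  obtain U where U: "ultra U" "eventually (\<lambda>g. g \<in> Sinf) U" "\<And>f. f \<in> LUC \<Longrightarrow> (f \<longlongrightarrow> p f) U"
    using SG_ultra[OF p] by blast
  have "eventually (\<lambda>g. g \<in> Sinf \<and> (\<forall>a\<in>A. \<forall>b\<in>A. g a < g b \<longleftrightarrow> lt p a b)) U"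
    by (intro eventually_conj U SG_order_ultra A)
  from eventually_happens'[OF ultra_nontrivial[OF U(1)] this] show thesis
    using that by blast
qed

text \<open>On \<open>{a, b}\<close> both relations are pulled back from the usual order by
  injective maps, so trichotomy recovers the case \<open>b < a\<close> from the case
  \<open>a < b\<close>.\<close>

lemma lt_eqI:
  assumes p: "p \<in> SG" and q: "q \<in> SG" and eq: "\<And>i j. i < j \<Longrightarrow> lt p i j \<longleftrightarrow> lt q i j"
  shows "lt p = lt q"
proof (intro ext)
  fix a b
  obtain g where g: "g \<in> Sinf" "\<And>i j. i \<in> {a, b} \<Longrightarrow> j \<in> {a, b} \<Longrightarrow> g i < g j \<longleftrightarrow> lt p i j"
    using SG_order[OF p, of "{a, b}"] by blast
  obtain h where h: "h \<in> Sinf" "\<And>i j. i \<in> {a, b} \<Longrightarrow> j \<in> {a, b} \<Longrightarrow> h i < h j \<longleftrightarrow> lt q i j"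
    using SG_order[OF q, of "{a, b}"] by blast
  have "inj g" "inj h"
    using g(1) h(1) by (auto simp: Sinf_def bij_def)
  then have "g a = g b \<longleftrightarrow> a = b" "h a = h b \<longleftrightarrow> a = b"
    by (auto simp: inj_eq)
  then show "lt p a b = lt q a b"
    using g(2)[of a b] g(2)[of b a] h(2)[of a b] h(2)[of b a] eq[of a b] eq[of b a]
    by (cases a b rule: linorder_cases) auto
qed

lemma translates_inc: "h \<in> Sinf \<Longrightarrow> translates w (inc a b) h = w (inc (h a) (h b))"
  by (simp add: translates_apply shift_inc)

text \<open>\<open>s\<close> lists \<open>{..<n}\<close> by increasing value of \<open>g\<close>:
  enumerate the image of \<open>{..<n}\<close> increasingly, pull back along \<open>g\<close>, and
  extend to a permutation.\<close>

lemma sort_initial_segment: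
  assumes g: "g \<in> Sinf"
  obtains s where "s \<in> Sinf" "s ` {..<n} = {..<n}" "strict_mono_on {..<n} (g \<circ> s)"
proof -
  have bij: "bij g"
    using g by (simp add: Sinf_def)
  then have "inj_on g {..<n}"
    by (meson bij_is_inj inj_on_subset subset_UNIV)
  then have "card (g ` {..<n}) = n"
    by (simp add: card_image)
  then obtain h where h: "bij_betw h {..<n} (g ` {..<n})" "strict_mono_on {..<n} h"
    using ex_bij_betw_strict_mono_card[of "g ` {..<n}"] by auto
  have inj: "inj_on (inv g \<circ> h) {..<n}"
    using h(1) by (intro comp_inj_on inj_on_inv_into) (auto simp: bij_betw_def)
  obtain s where s: "bij s" "\<And>i. i < n \<Longrightarrow> s i = (inv g \<circ> h) i"
    using inj_on_extends_bij[OF inj] by blast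
  have "s ` {..<n} = inv g ` h ` {..<n}"
    using s(2) by (auto simp: image_iff)
  also have "\<dots> = {..<n}"
    using h(1) bij by (simp add: bij_betw_def image_inv_f_f bij_is_inj)
  finally have "s ` {..<n} = {..<n}" .
  moreover have "(g \<circ> s) i = h i" if "i < n" for i
    using that s(2) bij by (simp add: bij_is_surj surj_f_inv_f)
  ultimately show thesis
    using that[of s] s(1) h(2) by (auto simp: Sinf_def strict_mono_on_def)
qed

text \<open>Sorting \<open>{..<n}\<close> by the order of \<open>w\<close> gives a permutation along
  which \<open>w\<close> increases on the first \<open>n\<close> arguments; \<open>lt sg_one\<close>
  is the usual order of \<open>nat\<close>.\<close>

lemma ex_increasing_translate:
  assumes w: "w \<in> SG"
  shows "\<exists>v\<in>SG. lt (mul w v) = lt sg_one"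
proof -
  have "\<exists>v\<in>Sinf. \<forall>i j. i < j \<longrightarrow> j < n \<longrightarrow> lt w (v i) (v j)" for n
  proof -
    obtain g where g: "g \<in> Sinf" "\<And>a b. a < n \<Longrightarrow> b < n \<Longrightarrow> g a < g b \<longleftrightarrow> lt w a b"
      using SG_order[OF w, of "{..<n}"] by auto
    obtain s where s: "s \<in> Sinf" "s ` {..<n} = {..<n}" "strict_mono_on {..<n} (g \<circ> s)"
      using sort_initial_segment[OF g(1)] by blast
    have "lt w (s i) (s j)" if "i < j" "j < n" for i j
    proof -
      have "s i \<in> s ` {..<n}" "s j \<in> s ` {..<n}"
        using that by auto
      then have "s i < n" "s j < n"
        unfolding s(2) by auto
      then show ?thesis
        using g(2)[of "s i" "s j"] s(3) that by (auto simp: strict_mono_on_def)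
    qed
    then show ?thesis
      using s(1) by blast
  qed
  then obtain v where v: "\<And>n. v n \<in> Sinf" "\<And>n i j. i < j \<Longrightarrow> j < n \<Longrightarrow> lt w (v n i) (v n j)"
    by metis
  obtain V :: "nat filter" where V: "ultra V" "V \<le> sequentially"
    using ex_nonprincipal_ultra by blast
  \<comment> \<open>The limit of the sorting permutations along \<open>V\<close>. A fixed pair
    \<open>i < j\<close> lies below \<open>n\<close> for almost all \<open>n\<close>, so it is
    sorted in the limit.\<close>
  define U where "U = filtermap v V"
  have U: "ultra U" "eventually (\<lambda>g. g \<in> Sinf) U"
    using V(1) v(1) by (auto simp: U_def ultra_def eventually_filtermap filtermap_bot_iff)
  have SG: "ulim U \<in> SG"
    by (rule ulim_SG[OF U])
  have "lt (mul w (ulim U)) i j \<longleftrightarrow> lt sg_one i j" if "i < j" for i j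
  proof -
    have "eventually (\<lambda>n. j < n) V"
      using V(2) eventually_gt_at_top filter_leD by blast
    then have "eventually (\<lambda>n. translates w (inc i j) (v n) = 1) V"
      by (rule eventually_mono) (use v that in \<open>simp add: translates_inc lt_def\<close>)
    then have "eventually (\<lambda>g. translates w (inc i j) g = 1) U"
      by (simp add: U_def eventually_filtermap)
    then have "ulim U (translates w (inc i j)) = 1"
      by (intro ulim_eqI U translates_LUC w inc_LUC tendsto_eventually)
    moreover have "sg_one (inc i j) = 1"
      using that Sinf_id by (simp add: sg_one_def inc_LUC) (simp add: inc_def)
    ultimately show ?thesis
      by (simp add: lt_def mul_apply inc_LUC)
  qed
  then have "lt (mul w (ulim U)) = lt sg_one"
    by (intro lt_eqI mul_SG w SG sg_one_SG)
  then show ?thesis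
    using SG by blast
qed


section \<open>Order-indiscernible points\<close>

text \<open>Here \<open>g\<close> and \<open>h\<close> serve as injective tuples of length
  \<open>n\<close>: the law under \<open>W\<close> of the values at a tuple depends only on its
  order pattern. One implication is enough, since the two tuples can be exchanged.\<close>

definition indiscernible :: "perm filter \<Rightarrow> bool" where
  "indiscernible W \<longleftrightarrow> (\<forall>n. \<forall>g\<in>Sinf. \<forall>h\<in>Sinf. \<forall>P.
     (\<forall>i<n. \<forall>j<n. g i < g j \<longleftrightarrow> h i < h j) \<longrightarrow>
     (\<forall>c c'. (\<forall>i<n. c i = c' i) \<longrightarrow> P c = P c') \<longrightarrow>
     eventually (\<lambda>k. P (k \<circ> g)) W \<longrightarrow> eventually (\<lambda>k. P (k \<circ> h)) W)"

text \<open>Replace \<open>t\<close> and \<open>t'\<close> by permutations \<open>g\<close> and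
  \<open>h\<close> with the same order pattern below \<open>N\<close>, at a cost of \<open>e\<close>
  each; comparing \<open>g\<close> with \<open>h\<close> by indiscernibility costs another
  \<open>2 * e\<close>.\<close>

lemma indiscernible_mul_le:
  assumes W: "ultra W" "eventually (\<lambda>g. g \<in> Sinf) W" and ind: "indiscernible W"
    and t: "t \<in> SG" "t' \<in> SG" "lt t = lt t'" and f: "f \<in> LUC" and e: "e > 0"
  shows "\<bar>mul (ulim W) t f - mul (ulim W) t' f\<bar> \<le> 4 * e"
proof -
  let ?x = "ulim W"
  let ?F = "translates ?x f"
  have x: "?x \<in> SG"
    by (rule ulim_SG[OF W])
  have F: "?F \<in> LUC"
    by (rule translates_LUC[OF x f])
  obtain N where N: "\<And>g h. g \<in> Sinf \<Longrightarrow> h \<in> Sinf \<Longrightarrow> (\<And>i. i < N \<Longrightarrow> g i = h i) \<Longrightarrow> \<bar>f g - f h\<bar> < e"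
    using LUC_modulus[OF f e] by blast
  have approx: "\<exists>g\<in>Sinf. \<bar>?F g - q ?F\<bar> < e \<and> (\<forall>i<N. \<forall>j<N. g i < g j \<longleftrightarrow> lt q i j)"
    if q: "q \<in> SG" for q
  proof -
    obtain U where U: "ultra U" "eventually (\<lambda>g. g \<in> Sinf) U" "\<And>f. f \<in> LUC \<Longrightarrow> (f \<longlongrightarrow> q f) U"
      using SG_ultra[OF q] by blast
    have "eventually (\<lambda>g. dist (?F g) (q ?F) < e) U"
      using U(3)[OF F] e by (rule tendstoD)
    moreover have "eventually (\<lambda>g. \<forall>a\<in>{..<N}. \<forall>b\<in>{..<N}. g a < g b \<longleftrightarrow> lt q a b) U"
      by (rule SG_order_ultra[OF U]) auto
    ultimately have "eventually (\<lambda>g. g \<in> Sinf \<and> \<bar>?F g - q ?F\<bar> < e \<and>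
        (\<forall>i<N. \<forall>j<N. g i < g j \<longleftrightarrow> lt q i j)) U"
      using U(2) by eventually_elim (simp add: dist_real_def)
    from eventually_happens'[OF ultra_nontrivial[OF U(1)] this] show ?thesis
      by blast
  qed
  obtain g where g: "g \<in> Sinf" "\<bar>?F g - t ?F\<bar> < e" "\<And>i j. i < N \<Longrightarrow> j < N \<Longrightarrow> g i < g j \<longleftrightarrow> lt t i j"
    using approx[OF t(1)] by blast
  obtain h where h: "h \<in> Sinf" "\<bar>?F h - t' ?F\<bar> < e" "\<And>i j. i < N \<Longrightarrow> j < N \<Longrightarrow> h i < h j \<longleftrightarrow> lt t' i j"
    using approx[OF t(2)] by blast
  have lim: "(shift f k \<longlongrightarrow> ?F k) W" if "k \<in> Sinf" for k
    using ulim_tendsto[OF W(1) shift_LUC[OF f that]] that by (simp add: translates_apply)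
  \<comment> \<open>\<open>f\<close> may depend on all values of a permutation, but indiscernibility
    concerns finitely many; so \<open>P\<close> asks only for some permutation starting with
    \<open>c\<close> at which \<open>f\<close> is close to the limit.\<close>
  define P where "P c \<longleftrightarrow> (\<exists>k\<in>Sinf. (\<forall>i<N. k i = c i) \<and> \<bar>f k - ?F g\<bar> < e)" for c
  have "eventually (\<lambda>k. dist (shift f g k) (?F g) < e) W"
    using lim[OF g(1)] e by (rule tendstoD)
  then have "eventually (\<lambda>k. P (k \<circ> g)) W"
    using W(2)
  proof eventually_elim
    case (elim k)
    then show ?case
      unfolding P_def using g(1)
      by (intro bexI[of _ "k \<circ> g"]) (auto simp: shift_apply dist_real_def)
  qed
  moreover have "\<forall>i<N. \<forall>j<N. g i < g j \<longleftrightarrow> h i < h j"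
    using g(3) h(3) t(3) by simp
  moreover have "\<forall>c c'. (\<forall>i<N. c i = c' i) \<longrightarrow> P c = P c'"
    by (simp add: P_def)
  ultimately have "eventually (\<lambda>k. P (k \<circ> h)) W"
    using ind g(1) h(1) unfolding indiscernible_def by blast
  \<comment> \<open>One \<open>e\<close> comes from \<open>P\<close>, the other from exchanging its
    witness for \<open>k \<circ> h\<close>, which agrees with it below \<open>N\<close>.\<close>
  then have "eventually (\<lambda>k. \<bar>shift f h k - ?F g\<bar> \<le> 2 * e) W"
    using W(2)
  proof eventually_elim
    case (elim k)
    then obtain k' where k': "k' \<in> Sinf" "\<forall>i<N. k' i = (k \<circ> h) i" "\<bar>f k' - ?F g\<bar> < e"
      by (auto simp: P_def)
    have "\<bar>f k' - f (k \<circ> h)\<bar> < e"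
      using k' elim h(1) by (intro N) auto
    then show ?case
      using k'(3) elim by (simp add: shift_apply)
  qed
  moreover have "((\<lambda>k. \<bar>shift f h k - ?F g\<bar>) \<longlongrightarrow> \<bar>?F h - ?F g\<bar>) W"
    by (intro tendsto_intros lim h)
  ultimately have "\<bar>?F h - ?F g\<bar> \<le> 2 * e"
    using ultra_nontrivial[OF W(1)] by (metis tendsto_upperbound)
  then show ?thesis
    using g(2) h(2) f by (simp add: mul_apply)
qed

lemma indiscernible_mul_eq:
  assumes "ultra W" "eventually (\<lambda>g. g \<in> Sinf) W" "indiscernible W"
    and "t \<in> SG" "t' \<in> SG" "lt t = lt t'"
  shows "mul (ulim W) t = mul (ulim W) t'"
proof
  fix f
  show "mul (ulim W) t f = mul (ulim W) t' f"
  proof (cases "f \<in> LUC")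
    case True
    have "\<bar>mul (ulim W) t f - mul (ulim W) t' f\<bar> \<le> 0 + e" if "e > 0" for e
      using indiscernible_mul_le[OF assms True, of "e/4"] that by simp
    then have "\<bar>mul (ulim W) t f - mul (ulim W) t' f\<bar> \<le> 0"
      by (rule field_le_epsilon)
    then show ?thesis
      by simp
  qed (simp add: mul_def)
qed

lemma indiscernible_in_KSG:
  assumes W: "ultra W" "eventually (\<lambda>g. g \<in> Sinf) W" "indiscernible W"
  shows "ulim W \<in> KSG"
proof (rule in_KSG)
  show x: "ulim W \<in> SG"
    by (rule ulim_SG[OF W(1,2)])
  fix w assume w: "w \<in> SG"
  obtain v where v: "v \<in> SG" "lt (mul w v) = lt sg_one"
    using ex_increasing_translate[OF w] by blast
  have "mul (mul (ulim W) w) v = mul (ulim W) (mul w v)"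
    by (rule mul_assoc[OF x w])
  also have "\<dots> = mul (ulim W) sg_one"
    by (intro indiscernible_mul_eq W mul_SG w v sg_one_SG)
  also have "\<dots> = ulim W"
    by (rule mul_one_right[OF x])
  finally show "\<exists>v\<in>SG. mul (mul (ulim W) w) v = ulim W"
    using v(1) by blast
qed


section \<open>Points generated by pairs from an ultrafilter\<close>

text \<open>\<open>\<alpha> n i\<close> and \<open>\<beta> n i\<close> are the positions, in a generic sequence of length \<open>2 * n\<close>, of the two
  entries that are paired to give the value at \<open>i\<close>. Coherence says that an increasing map of arguments
  is covered by an increasing map of positions, so that the values at an \<open>n\<close>-element subset of
  \<open>{..<m}\<close> are distributed like those at \<open>{..<n}\<close>.\<close>

locale pairing =
  fixes V :: "nat filter" and \<alpha> \<beta> :: "nat \<Rightarrow> nat \<Rightarrow> nat"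
  assumes V: "ultra V" "V \<le> sequentially"
    and less: "i < n \<Longrightarrow> \<alpha> n i < 2 * n" "i < n \<Longrightarrow> \<beta> n i < 2 * n"
    and inj: "inj_on (\<alpha> n) {..<n}"
    and coherent: "strict_mono_on {..<n} h \<Longrightarrow> h ` {..<n} \<subseteq> {..<m} \<Longrightarrow>
      \<exists>s. strict_mono_on {..<2 * n} s \<and> s ` {..<2 * n} \<subseteq> {..<2 * m} \<and>
          (\<forall>i<n. s (\<alpha> n i) = \<alpha> m (h i) \<and> s (\<beta> n i) = \<beta> m (h i))"
begin

definition pick :: "nat \<Rightarrow> (nat \<Rightarrow> nat) \<Rightarrow> nat \<Rightarrow> nat" where
  "pick n c i = prod_encode (c (\<alpha> n i), c (\<beta> n i))"

text \<open>The laws of the restrictions to \<open>{..<n}\<close>, for all \<open>n\<close>, glued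
  into one filter. It decides predicates of finitely many values; an ultrafilter below it settles
  the rest.\<close>

definition F :: "perm filter" where
  "F = Abs_filter (\<lambda>Q. \<exists>n. gen V (2 * n) (\<lambda>c. \<forall>k\<in>Sinf. (\<forall>i<n. k i = pick n c i) \<longrightarrow> Q k))"

lemma gen_pick_reindex:
  assumes h: "strict_mono_on {..<n} h" "h ` {..<n} \<subseteq> {..<m}"
    and P: "\<And>c c'. (\<And>i. i < n \<Longrightarrow> c i = c' i) \<Longrightarrow> P c = P c'"
  shows "gen V (2 * m) (\<lambda>c. P (pick m c \<circ> h)) \<longleftrightarrow> gen V (2 * n) (\<lambda>c. P (pick n c))"
proof -
  obtain s where s: "strict_mono_on {..<2 * n} s" "s ` {..<2 * n} \<subseteq> {..<2 * m}"
      "\<And>i. i < n \<Longrightarrow> s (\<alpha> n i) = \<alpha> m (h i) \<and> s (\<beta> n i) = \<beta> m (h i)"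
    using coherent[OF h] by blast
  have "P (pick m c \<circ> h) = P (pick n (c \<circ> s))" for c
    by (rule P) (simp add: pick_def s(3))
  then have "gen V (2 * m) (\<lambda>c. P (pick m c \<circ> h)) \<longleftrightarrow> gen V (2 * m) (\<lambda>c. P (pick n (c \<circ> s)))"
    by simp
  also have "\<dots> \<longleftrightarrow> gen V (2 * n) (\<lambda>c. P (pick n c))"
  proof (rule gen_reindex[OF V(1) s(1,2)])
    fix c c' :: "nat \<Rightarrow> nat" assume "\<And>i. i < 2 * n \<Longrightarrow> c i = c' i"
    then show "P (pick n c) = P (pick n c')"
      by (intro P) (simp add: pick_def less)
  qed
  finally show ?thesis .
qed

lemma eventually_F:
  "eventually Q F \<longleftrightarrow> (\<exists>n. gen V (2 * n) (\<lambda>c. \<forall>k\<in>Sinf. (\<forall>i<n. k i = pick n c i) \<longrightarrow> Q k))"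
  unfolding F_def
proof (rule eventually_Abs_filter, rule is_filter.intro)
  show "\<exists>n. gen V (2 * n) (\<lambda>c. \<forall>k\<in>Sinf. (\<forall>i<n. k i = pick n c i) \<longrightarrow> True)"
    using gen_const[OF V(1)] by simp
next
  fix P Q
  assume "\<exists>n. gen V (2 * n) (\<lambda>c. \<forall>k\<in>Sinf. (\<forall>i<n. k i = pick n c i) \<longrightarrow> P k)"
    and "\<exists>n. gen V (2 * n) (\<lambda>c. \<forall>k\<in>Sinf. (\<forall>i<n. k i = pick n c i) \<longrightarrow> Q k)"
  then obtain n m where nm:
      "gen V (2 * n) (\<lambda>c. \<forall>k\<in>Sinf. (\<forall>i<n. k i = pick n c i) \<longrightarrow> P k)"
      "gen V (2 * m) (\<lambda>c. \<forall>k\<in>Sinf. (\<forall>i<m. k i = pick m c i) \<longrightarrow> Q k)"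
    by blast
  \<comment> \<open>Coherence for the identity restates a condition of level \<open>n\<close> at any
    higher level, so two conditions can be met at a common one.\<close>
  have mono: "gen V (2 * l) (\<lambda>c. \<forall>k\<in>Sinf. (\<forall>i<l. k i = pick l c i) \<longrightarrow> R k)"
    if "gen V (2 * n) (\<lambda>c. \<forall>k\<in>Sinf. (\<forall>i<n. k i = pick n c i) \<longrightarrow> R k)" "n \<le> l" for n l R
  proof -
    have "gen V (2 * l) (\<lambda>c. \<forall>k\<in>Sinf. (\<forall>i<n. k i = (pick l c \<circ> id) i) \<longrightarrow> R k)"
      using gen_pick_reindex[of n id l "\<lambda>d. \<forall>k\<in>Sinf. (\<forall>i<n. k i = d i) \<longrightarrow> R k"] that
      by (simp add: strict_mono_on_def)
    then show ?thesis
      by (rule gen_mono) (use that(2) in auto)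
  qed
  have "gen V (2 * max n m) (\<lambda>c. \<forall>k\<in>Sinf. (\<forall>i<max n m. k i = pick (max n m) c i) \<longrightarrow> P k \<and> Q k)"
    using mono[OF nm(1), of "max n m"] mono[OF nm(2), of "max n m"]
    unfolding imp_conjR ball_conj_distrib gen_conj by simp
  then show "\<exists>n. gen V (2 * n) (\<lambda>c. \<forall>k\<in>Sinf. (\<forall>i<n. k i = pick n c i) \<longrightarrow> P k \<and> Q k)"
    by blast
next
  fix P Q :: "perm \<Rightarrow> bool"
  assume "\<forall>x. P x \<longrightarrow> Q x"
    and "\<exists>n. gen V (2 * n) (\<lambda>c. \<forall>k\<in>Sinf. (\<forall>i<n. k i = pick n c i) \<longrightarrow> P k)"
  then show "\<exists>n. gen V (2 * n) (\<lambda>c. \<forall>k\<in>Sinf. (\<forall>i<n. k i = pick n c i) \<longrightarrow> Q k)"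
    by (elim exE, intro exI) (erule gen_mono, blast)
qed

text \<open>A generic sequence increases, so injectivity of \<open>\<alpha> n\<close> makes
  \<open>pick n c\<close> injective on \<open>{..<n}\<close>; it therefore extends to a
  permutation.\<close>

lemma F_nontrivial: "F \<noteq> bot"
proof
  assume "F = bot"
  then obtain n where "gen V (2 * n) (\<lambda>c. \<forall>k\<in>Sinf. (\<forall>i<n. k i = pick n c i) \<longrightarrow> False)"
    using eventually_F[of "\<lambda>_. False"] by (auto simp: trivial_limit_def)
  with gen_strict_mono[OF V]
  have "gen V (2 * n) (\<lambda>c. strict_mono_on {..<2 * n} c \<and>
      (\<forall>k\<in>Sinf. (\<forall>i<n. k i = pick n c i) \<longrightarrow> False))"
    by (simp add: gen_conj)
  then have "gen V (2 * n) (\<lambda>_. False)"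
  proof (rule gen_mono)
    fix c
    assume c: "strict_mono_on {..<2 * n} c \<and> (\<forall>k\<in>Sinf. (\<forall>i<n. k i = pick n c i) \<longrightarrow> False)"
    have "inj_on c {..<2 * n}"
      using c strict_mono_on_imp_inj_on by blast
    then have "inj_on (c \<circ> \<alpha> n) {..<n}"
      using inj less by (intro comp_inj_on) (auto intro: inj_on_subset)
    then have "inj_on (pick n c) {..<n}"
      by (auto simp: inj_on_def pick_def)
    then obtain k where "bij k" "\<And>i. i < n \<Longrightarrow> k i = pick n c i"
      using inj_on_extends_bij by blast
    then show False
      using c by (auto simp: Sinf_def)
  qed
  then show False
    by (simp add: gen_const[OF V(1)])
qed

lemma eventually_F_pick:
  assumes h: "strict_mono_on {..<n} h"
    and P: "\<And>c c'. (\<And>i. i < n \<Longrightarrow> c i = c' i) \<Longrightarrow> P c = P c'"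
    and gen: "gen V (2 * n) (\<lambda>c. P (pick n c))"
  shows "eventually (\<lambda>k. P (k \<circ> h)) F"
proof -
  obtain m where m: "h ` {..<n} \<subseteq> {..<m}"
    using finite_nat_set_iff_bounded[of "h ` {..<n}"] by auto
  have "gen V (2 * m) (\<lambda>c. P (pick m c \<circ> h)) \<longleftrightarrow> gen V (2 * n) (\<lambda>c. P (pick n c))"
    using h m P by (rule gen_pick_reindex)
  with gen have "gen V (2 * m) (\<lambda>c. P (pick m c \<circ> h))"
    by (simp only:)
  then have "gen V (2 * m) (\<lambda>c. \<forall>k\<in>Sinf. (\<forall>i<m. k i = pick m c i) \<longrightarrow> P (k \<circ> h))"
  proof (rule gen_mono, intro ballI impI)
    fix c k assume c: "P (pick m c \<circ> h)" and k: "\<forall>i<m. k i = pick m c i"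
    have "P (k \<circ> h) = P (pick m c \<circ> h)"
      by (rule P) (use k m in auto)
    then show "P (k \<circ> h)"
      using c by simp
  qed
  then show ?thesis
    by (auto simp: eventually_F)
qed

section \<open>Ultrafilters refining the filter of generic pairs\<close>

context
  fixes W :: "perm filter"
  assumes W: "ultra W" "W \<le> F"
begin

lemma eventually_Sinf: "eventually (\<lambda>k. k \<in> Sinf) W"
proof -
  have "eventually (\<lambda>k. k \<in> Sinf) F"
    using gen_const[OF V(1)] by (auto simp: eventually_F intro!: exI[of _ 0])
  then show ?thesis
    using W(2) filter_leD by blast
qed

text \<open>\<open>F\<close> already decides predicates of finitely many values, by self-duality of
  \<open>gen\<close>. The right-hand side mentions neither \<open>h\<close> nor \<open>W\<close>:
  all increasing tuples have the same law.\<close>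

lemma eventually_pick:
  assumes h: "strict_mono_on {..<n} h"
    and P: "\<And>c c'. (\<And>i. i < n \<Longrightarrow> c i = c' i) \<Longrightarrow> P c = P c'"
  shows "eventually (\<lambda>k. P (k \<circ> h)) W \<longleftrightarrow> gen V (2 * n) (\<lambda>c. P (pick n c))"
proof
  assume "gen V (2 * n) (\<lambda>c. P (pick n c))"
  with h P have "eventually (\<lambda>k. P (k \<circ> h)) F"
    by (rule eventually_F_pick)
  with W(2) show "eventually (\<lambda>k. P (k \<circ> h)) W"
    by (rule filter_leD)
next
  assume ev: "eventually (\<lambda>k. P (k \<circ> h)) W"
  show "gen V (2 * n) (\<lambda>c. P (pick n c))"
  proof (rule ccontr)
    assume "\<not> gen V (2 * n) (\<lambda>c. P (pick n c))"
    then have "gen V (2 * n) (\<lambda>c. \<not> P (pick n c))"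
      by (simp add: gen_not[OF V(1)])
    then have "eventually (\<lambda>k. \<not> P (k \<circ> h)) F"
      by (intro eventually_F_pick[of n h "\<lambda>c. \<not> P c"] h arg_cong[of _ _ Not] P)
    with W(2) have "eventually (\<lambda>k. \<not> P (k \<circ> h)) W"
      by (rule filter_leD)
    then show False
      using ev by (simp add: ultra_eventually_not[OF W(1)])
  qed
qed

lemma indiscernible: "indiscernible W"
  unfolding indiscernible_def
proof (intro allI ballI impI)
  fix n g h and P :: "(nat \<Rightarrow> nat) \<Rightarrow> bool"
  assume g: "g \<in> Sinf" and h: "h \<in> Sinf"
    and eq: "\<forall>i<n. \<forall>j<n. g i < g j \<longleftrightarrow> h i < h j"
    and P: "\<forall>c c'. (\<forall>i<n. c i = c' i) \<longrightarrow> P c = P c'"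
    and ev: "eventually (\<lambda>k. P (k \<circ> g)) W"
  obtain s where s: "s \<in> Sinf" "s ` {..<n} = {..<n}" "strict_mono_on {..<n} (g \<circ> s)"
    using sort_initial_segment[OF g] by blast
  have s_less: "s i < n" if "i < n" for i
    using imageI[of i "{..<n}" s] that unfolding s(2) by simp
  have mono_h: "strict_mono_on {..<n} (h \<circ> s)"
    using s(3) eq s_less by (auto simp: strict_mono_on_def)
  have bij: "bij s"
    using s(1) by (simp add: Sinf_def)
  have inv_less: "inv s i < n" if "i < n" for i
  proof -
    have "i \<in> s ` {..<n}"
      using s(2) that by simp
    then show ?thesis
      using bij by (auto simp: bij_is_inj)
  qed
  \<comment> \<open>The same \<open>s\<close> sorts both tuples because their order patterns agree;
    \<open>P'\<close> permutes the arguments back, reducing the claim to increasing tuples.\<close>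
  define P' where "P' c = P (c \<circ> inv s)" for c :: "nat \<Rightarrow> nat"
  have P': "P' c = P' c'" if "\<And>i. i < n \<Longrightarrow> c i = c' i" for c c'
    unfolding P'_def using P that inv_less by simp
  have "k \<circ> (f \<circ> s) \<circ> inv s = k \<circ> f" for k f :: "nat \<Rightarrow> nat"
    using bij by (simp add: comp_assoc bij_is_surj surj_iff[THEN iffD1])
  then have P'_eq: "P' (k \<circ> (f \<circ> s)) = P (k \<circ> f)" for k f :: "nat \<Rightarrow> nat"
    by (simp add: P'_def)
  have "eventually (\<lambda>k. P' (k \<circ> (g \<circ> s))) W \<longleftrightarrow> eventually (\<lambda>k. P' (k \<circ> (h \<circ> s))) W"
    using eventually_pick[OF s(3), of P'] eventually_pick[OF mono_h, of P'] P' by blast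
  then show "eventually (\<lambda>k. P (k \<circ> h)) W"
    using ev by (simp add: P'_eq)
qed

text \<open>The product with \<open>w\<close> orders \<open>i\<close> and \<open>j\<close> as
  \<open>w\<close> orders the generic values there. For \<open>i < j\<close> these two values have
  the law of \<open>pick 2 c\<close>, which uses four positions, whatever \<open>i\<close> and
  \<open>j\<close> are.\<close>

lemma lt_mul_iff:
  assumes w: "w \<in> SG" and "i < j"
  shows "lt (mul w (ulim W)) i j \<longleftrightarrow> gen V 4 (\<lambda>c. lt w (pick 2 c 0) (pick 2 c 1))"
proof -
  define h :: "nat \<Rightarrow> nat" where "h m = (if m = 0 then i else j)" for m
  have h: "strict_mono_on {..<2} h"
    using \<open>i < j\<close> by (auto simp: strict_mono_on_def h_def)
  have ev: "eventually (\<lambda>k. lt w (k i) (k j)) W \<longleftrightarrow> gen V 4 (\<lambda>c. lt w (pick 2 c 0) (pick 2 c 1))"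
    using eventually_pick[OF h, of "\<lambda>c. lt w (c 0) (c 1)"] by (simp add: h_def)
  have lim: "(translates w (inc i j) \<longlongrightarrow> mul w (ulim W) (inc i j)) W"
    using ulim_tendsto[OF W(1) translates_LUC[OF w inc_LUC]] by (simp add: mul_apply inc_LUC)
  show ?thesis
  proof (cases "eventually (\<lambda>k. lt w (k i) (k j)) W")
    case True
    then have "eventually (\<lambda>k. translates w (inc i j) k = 1) W"
      using eventually_Sinf by eventually_elim (simp add: translates_inc lt_def)
    then have "mul w (ulim W) (inc i j) = 1"
      using lim tendsto_eventually tendsto_unique[OF ultra_nontrivial[OF W(1)]] by blast
    then show ?thesis
      using ev True by (simp add: lt_def)
  next
    case False
    then have "eventually (\<lambda>k. \<not> lt w (k i) (k j)) W"
      by (simp add: ultra_eventually_not[OF W(1)])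
    then have "eventually (\<lambda>k. translates w (inc i j) k = 0) W"
      using eventually_Sinf by eventually_elim (simp add: translates_inc SG_inc[OF w])
    then have "mul w (ulim W) (inc i j) = 0"
      using lim tendsto_eventually tendsto_unique[OF ultra_nontrivial[OF W(1)]] by blast
    then show ?thesis
      using ev False by (simp add: lt_def)
  qed
qed

end

end

text \<open>Along a generic sequence, the pairs \<open>02, 13, 24, 35, 46\<close> form a chain whose consecutive members
  have the second type and whose ends have the first type.\<close>

lemma gen_lt_blocks_iff:
  assumes V: "ultra V" and w: "w \<in> SG"
  shows "gen V 4 (\<lambda>c. lt w (prod_encode (c 0, c 1)) (prod_encode (c 2, c 3))) \<longleftrightarrow>
    gen V 4 (\<lambda>c. lt w (prod_encode (c 0, c 2)) (prod_encode (c 1, c 3)))"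
    (is "?A \<longleftrightarrow> ?B")
proof (rule ccontr)
  assume neq: "\<not> ?thesis"
  define e :: "nat \<Rightarrow> nat \<Rightarrow> (nat \<Rightarrow> nat) \<Rightarrow> nat" where "e i j c = prod_encode (c i, c j)" for i j c
  \<comment> \<open>Seven entries, since the chain from 02 to 46 uses positions 0 to 6.
    \<open>A\<close> is applied to the positions 0, 2, 4, 6 of the ends, \<open>B\<close> to four
    consecutive positions at each link.\<close>
  have A: "gen V 7 (\<lambda>c. lt w (e i j c) (e k l c)) \<longleftrightarrow> ?A" if "i < j" "j < k" "k < l" "l < 7" for i j k l
    unfolding e_def
    by (rule gen_four[OF V that, of "\<lambda>p q r s. lt w (prod_encode (p, q)) (prod_encode (r, s))"])
  have B: "gen V 7 (\<lambda>c. lt w (e i k c) (e j l c)) \<longleftrightarrow> ?B" if "i < j" "j < k" "k < l" "l < 7" for i j k l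
    unfolding e_def
    by (rule gen_four[OF V that, of "\<lambda>p q r s. lt w (prod_encode (p, r)) (prod_encode (q, s))"])
  have iff: "gen V 7 (\<lambda>c. Q c \<longleftrightarrow> b)" if "gen V 7 Q \<longleftrightarrow> b" for Q b
    using that by (cases b) (auto simp: gen_not[OF V])
  have "gen V 7 (\<lambda>c. (lt w (e 0 2 c) (e 4 6 c) \<longleftrightarrow> ?A) \<and>
     (lt w (e 0 2 c) (e 1 3 c) \<longleftrightarrow> ?B) \<and> (lt w (e 1 3 c) (e 2 4 c) \<longleftrightarrow> ?B) \<and>
     (lt w (e 2 4 c) (e 3 5 c) \<longleftrightarrow> ?B) \<and> (lt w (e 3 5 c) (e 4 6 c) \<longleftrightarrow> ?B))"
    unfolding gen_conj by (intro conjI iff A B) auto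
  then have "gen V 7 (\<lambda>_. False)"
  proof (rule gen_mono)
    fix c
    assume c: "(lt w (e 0 2 c) (e 4 6 c) \<longleftrightarrow> ?A) \<and>
     (lt w (e 0 2 c) (e 1 3 c) \<longleftrightarrow> ?B) \<and> (lt w (e 1 3 c) (e 2 4 c) \<longleftrightarrow> ?B) \<and>
     (lt w (e 2 4 c) (e 3 5 c) \<longleftrightarrow> ?B) \<and> (lt w (e 3 5 c) (e 4 6 c) \<longleftrightarrow> ?B)"
    define S where "S = {e 0 2 c, e 1 3 c, e 2 4 c, e 3 5 c, e 4 6 c}"
    have "finite S"
      by (simp add: S_def)
    then obtain g where "g \<in> Sinf" and g: "\<And>a b. a \<in> S \<Longrightarrow> b \<in> S \<Longrightarrow> g a < g b \<longleftrightarrow> lt w a b"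
      using SG_order[OF w, of S] by blast
    have "e 0 2 c \<in> S" "e 1 3 c \<in> S" "e 2 4 c \<in> S" "e 3 5 c \<in> S" "e 4 6 c \<in> S"
      by (simp_all add: S_def)
    then have "g (e 0 2 c) < g (e 4 6 c) \<longleftrightarrow> ?A" "g (e 0 2 c) < g (e 1 3 c) \<longleftrightarrow> ?B"
      "g (e 1 3 c) < g (e 2 4 c) \<longleftrightarrow> ?B" "g (e 2 4 c) < g (e 3 5 c) \<longleftrightarrow> ?B"
      "g (e 3 5 c) < g (e 4 6 c) \<longleftrightarrow> ?B"
      using c by (simp_all only: g)
    moreover have "A = B"
      if "p < t \<longleftrightarrow> A" "p < q \<longleftrightarrow> B" "q < r \<longleftrightarrow> B" "r < s \<longleftrightarrow> B" "s < t \<longleftrightarrow> B"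
      for p q r s t :: nat and A B
      using that by (cases B) auto
    ultimately show False
      using neq by blast
  qed
  then show False
    by (simp add: gen_const[OF V])
qed

section \<open>Coherence of the two arrangements of positions\<close>

lemma pairing_consecutive:
  assumes "ultra V" "V \<le> sequentially"
  shows "pairing V (\<lambda>n i. 2 * i) (\<lambda>n i. 2 * i + 1)"
proof
  fix n m :: nat and h :: "nat \<Rightarrow> nat"
  assume h: "strict_mono_on {..<n} h" "h ` {..<n} \<subseteq> {..<m}"
  \<comment> \<open>Position \<open>j\<close> is member \<open>j mod 2\<close> of pair
    \<open>j div 2\<close>; whole pairs are moved along \<open>h\<close>.\<close>
  define s where "s j = 2 * h (j div 2) + j mod 2" for j
  have "strict_mono_on {..<2 * n} s"
  proof (rule strict_mono_onI)
    fix i j assume ij: "i \<in> {..<2 * n}" "j \<in> {..<2 * n}" "i < j"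
    show "s i < s j"
    proof (cases "i div 2 = j div 2")
      case True
      then have "i mod 2 < j mod 2"
        using ij(3) by (metis add_less_cancel_left mult_div_mod_eq)
      then show ?thesis
        by (simp add: s_def True)
    next
      case False
      then have "i div 2 < j div 2" "j div 2 < n"
        using ij div_le_mono[of i j 2] by auto
      then have "h (i div 2) < h (j div 2)"
        using h(1) by (simp add: strict_mono_on_def)
      then show ?thesis
        using mod_less_divisor[of 2 i] unfolding s_def by linarith
    qed
  qed
  moreover have "s ` {..<2 * n} \<subseteq> {..<2 * m}"
  proof
    fix k assume "k \<in> s ` {..<2 * n}"
    then obtain j where j: "j < 2 * n" "k = s j"
      by auto
    then have "j div 2 \<in> {..<n}"
      by auto
    then have "h (j div 2) < m"
      using h(2) by blast
    then show "k \<in> {..<2 * m}"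
      using mod_less_divisor[of 2 j] unfolding j(2) s_def lessThan_iff by linarith
  qed
  ultimately show "\<exists>s. strict_mono_on {..<2 * n} s \<and> s ` {..<2 * n} \<subseteq> {..<2 * m} \<and>
      (\<forall>i<n. s (2 * i) = 2 * h i \<and> s (2 * i + 1) = 2 * h i + 1)"
    by (intro exI[of _ s]) (auto simp: s_def)
qed (use assms in \<open>auto simp: inj_on_def\<close>)

lemma pairing_blocks:
  assumes "ultra V" "V \<le> sequentially"
  shows "pairing V (\<lambda>n i. i) (\<lambda>n i. n + i)"
proof
  fix n m :: nat and h :: "nat \<Rightarrow> nat"
  assume h: "strict_mono_on {..<n} h" "h ` {..<n} \<subseteq> {..<m}"
  \<comment> \<open>First members fill the first half and second members the second, so
    \<open>h\<close> acts in each half, with offset \<open>n\<close> replaced by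
    \<open>m\<close>.\<close>
  define s where "s j = (if j < n then h j else m + h (j - n))" for j
  have less: "h i < m" if "i < n" for i
    using h(2) that by auto
  have mono: "h i < h j" if "i < j" "j < n" for i j
    using h(1) that by (simp add: strict_mono_on_def)
  have "strict_mono_on {..<2 * n} s"
  proof (rule strict_mono_onI)
    fix i j assume "i \<in> {..<2 * n}" "j \<in> {..<2 * n}" "i < j"
    then show "s i < s j"
      using mono[of i j] mono[of "i - n" "j - n"] less[of i] by (auto simp: s_def)
  qed
  moreover have "s ` {..<2 * n} \<subseteq> {..<2 * m}"
  proof
    fix k assume "k \<in> s ` {..<2 * n}"
    then obtain j where "j < 2 * n" "k = s j"
      by auto
    then show "k \<in> {..<2 * m}"
      using less[of j] less[of "j - n"] by (auto simp: s_def)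
  qed
  ultimately show "\<exists>s. strict_mono_on {..<2 * n} s \<and> s ` {..<2 * n} \<subseteq> {..<2 * m} \<and>
      (\<forall>i<n. s i = h i \<and> s (n + i) = m + h i)"
    by (intro exI[of _ s]) (auto simp: s_def)
qed (use assms in \<open>auto simp: inj_on_def\<close>)


section \<open>Two points identified by all retractions\<close>

theorem mainTheorem2:
  shows "\<exists>x\<in>KSG. \<exists>y\<in>KSG. x \<noteq> y \<and>
    (\<forall>M \<phi>. sg_minimal_subflow M \<and> sg_retraction M \<phi> \<longrightarrow> \<phi> x = \<phi> y)"
proof -
  obtain V :: "nat filter" where V: "ultra V" "V \<le> sequentially"
    using ex_nonprincipal_ultra by blast
  interpret C: pairing V "\<lambda>n i. 2 * i" "\<lambda>n i. 2 * i + 1"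
    by (rule pairing_consecutive[OF V])
  interpret B: pairing V "\<lambda>n i. i" "\<lambda>n i. n + i"
    by (rule pairing_blocks[OF V])
  \<comment> \<open>Any ultrafilter below \<open>C.F\<close> will do: indiscernibility and the
    induced order rest on predicates that \<open>C.F\<close> decides.\<close>
  obtain X where X: "ultra X" "X \<le> C.F"
    using ex_ultra_le[OF C.F_nontrivial] by blast
  obtain Y where Y: "ultra Y" "Y \<le> B.F"
    using ex_ultra_le[OF B.F_nontrivial] by blast
  note X_Sinf = C.eventually_Sinf[OF X] and Y_Sinf = B.eventually_Sinf[OF Y]
  note X_ind = C.indiscernible[OF X] and Y_ind = B.indiscernible[OF Y]
  have x: "ulim X \<in> SG" and y: "ulim Y \<in> SG"
    by (intro ulim_SG X Y X_Sinf Y_Sinf)+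
  have "mul (ulim X) (mul w (ulim X)) = mul (ulim X) (mul w (ulim Y))" if w: "w \<in> SG" for w
  proof -
    have "lt (mul w (ulim X)) i j \<longleftrightarrow> lt (mul w (ulim Y)) i j" if "i < j" for i j
      unfolding C.lt_mul_iff[OF X w that] B.lt_mul_iff[OF Y w that] C.pick_def B.pick_def
      using gen_lt_blocks_iff[OF V(1) w] by (simp add: numeral_3_eq_3 numeral_2_eq_2)
    then have "lt (mul w (ulim X)) = lt (mul w (ulim Y))"
      by (intro lt_eqI mul_SG w x y)
    then show ?thesis
      by (intro indiscernible_mul_eq X X_Sinf X_ind mul_SG w x y)
  qed
  then have "\<phi> (ulim X) = \<phi> (ulim Y)" if "sg_minimal_subflow M" "sg_retraction M \<phi>" for M \<phi>
    using retraction_identifies[OF x y] that by blast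
  moreover have "ulim X \<noteq> ulim Y"
  proof -
    \<comment> \<open>The second coordinate at 0 against the first at 1. For consecutive pairs this
      is \<open>c 1 < c 2\<close>, generically true; for blocks of length 2 it is
      \<open>c 2 < c 1\<close>, generically false.\<close>
    define P where "P c \<longleftrightarrow> snd (prod_decode (c 0)) < fst (prod_decode (c 1))" for c :: "nat \<Rightarrow> nat"
    define f where "f = on_G (\<lambda>k. if P k then 1 else 0)"
    have f: "f \<in> LUC"
      unfolding f_def by (rule on_G_LUC_cylinder[of _ 1 2]) (auto simp: P_def)
    have id: "strict_mono_on {..<2} (id :: nat \<Rightarrow> nat)"
      by (simp add: strict_mono_on_def)
    have "gen V 4 (\<lambda>c. c 1 < c 2)"
      by (rule gen_less[OF V]) auto
    then have "gen V (2 * 2) (\<lambda>c. P (C.pick 2 c))"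
      unfolding P_def C.pick_def by simp
    then have "eventually (\<lambda>k. P (k \<circ> id)) X"
      by (subst C.eventually_pick[OF X id]) (auto simp: P_def)
    then have "eventually (\<lambda>k. f k = 1) X"
      using X_Sinf by eventually_elim (simp add: f_def)
    then have "ulim X f = 1"
      by (intro ulim_eqI X f tendsto_eventually)
    moreover have "gen V 4 (\<lambda>c. \<not> c 2 < c 1)"
      by (rule gen_mono[OF gen_less[OF V, of 1 2 4]]) auto
    then have "gen V (2 * 2) (\<lambda>c. \<not> P (B.pick 2 c))"
      unfolding P_def B.pick_def by simp
    then have "eventually (\<lambda>k. \<not> P (k \<circ> id)) Y"
      by (subst B.eventually_pick[OF Y id]) (auto simp: P_def)
    then have "eventually (\<lambda>k. f k = 0) Y"
      using Y_Sinf by eventually_elim (simp add: f_def)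
    then have "ulim Y f = 0"
      by (intro ulim_eqI Y f tendsto_eventually)
    ultimately show ?thesis
      by auto
  qed
  moreover have "ulim X \<in> KSG" "ulim Y \<in> KSG"
    by (intro indiscernible_in_KSG X X_Sinf X_ind Y Y_Sinf Y_ind)+
  ultimately show ?thesis
    by blast
qed

end
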